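(* There is an absolute constant $c>0$ such that for every sufficiently large integer $n$ there exists a partial concept class $\mathbb{H}_n\subseteq\{0,1,\star\}^{[n]}$ with $\mathrm{LD}(\mathbb{H}_n)\le 2$ such that every disambiguation $\overline{\mathbb{H}}$ of $\mathbb{H}_n$ satisfies $\mathrm{LD}(\overline{\mathbb{H}})\ge \mathrm{VC}(\overline{\mathbb{H}})\ge c\log\log n$. Consequently, for the domain $\mathcal{X}=\mathbb{N}$ there exists a partial concept class $\mathbb{H}_\infty\subseteq\{0,1,\star\}^{\mathbb{N}}$ with $\mathrm{LD}(\mathbb{H}_\infty)\le 2$ such that every disambiguation $\overline{\mathbb{H}}$ of $\mathbb{H}_\infty$ satisfies $\mathrm{LD}(\overline{\mathbb{H}})\ge\mathrm{VC}(\overline{\mathbb{H}})=\infty$.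
   Context: A partial concept class on a domain $\mathcal{X}$ is a set $\mathbb{H}\subseteq\{0,1,\star\}^{\mathcal{X}}$ of functions $h:\mathcal{X}\to\{0,1,\star\}$; it is total if all functions take values in $\{0,1\}$. A finite set $\{x_1,\dots,x_d\}\subseteq\mathcal{X}$ is shattered by $\mathbb{H}$ if for every $y\in\{0,1\}^d$ there is $h\in\mathbb{H}$ with $h(x_i)=y_i$ for all $i$; $\mathrm{VC}(\mathbb{H})$ is the largest size of a shattered set ($\infty$ if unbounded). Consider a full binary tree of height $d$ whose internal nodes are indexed by strings $v\in\bigcup_{k=0}^{d-1}\{0,1\}^k$ (root = empty string, children of $v$ are $v0,v1$) and labelled by points $x_v\in\mathcal{X}$; it is shattered by $\mathbb{H}$ if for every $y\in\{0,1\}^d$ there is $h\in\mathbb{H}$ with $h(x_{y_1\cdots y_{i-1}})=y_i$ for all $i\in[d]$. The Littlestone dimension $\mathrm{LD}(\mathbb{H})$ is the largest $d$ for which such a shattered tree exists ($\infty$ if unbounded). A disambiguation of $\mathbb{H}$ is a total class $\overline{\mathbb{H}}\subseteq\{0,1\}^{\mathcal{X}}$ such that for every $h\in\mathbb{H}$ and every finite $S\subseteq h^{-1}(\{0,1\})$ there is $\bar h\in\overline{\mathbb{H}}$ agreeing with $h$ on $S$ (for finite $\mathcal{X}$ this means: for every $h\in\mathbb{H}$ some $\bar h\in\overline{\mathbb{H}}$ agrees with $h$ on all of $h^{-1}(\{0,1\})$). $[n]=\{1,\dots,n\}$. *)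

theory Defs
  imports "HOL-Analysis.Analysis" "HOL-Library.Extended_Nat"
begin

text \<open>Partial concepts: values in {0,1,star} are modelled as bool option,
  with None = star, Some False = 0, Some True = 1. A class on domain X is a set
  of functions; only points of X are relevant.\<close>

type_synonym 'a pconcept = "'a \<Rightarrow> bool option"

definition partial_class_on :: "'a set \<Rightarrow> 'a pconcept set \<Rightarrow> bool" where
  "partial_class_on X H \<longleftrightarrow> (\<forall>h\<in>H. \<forall>x. x \<notin> X \<longrightarrow> h x = None)"

definition total_class_on :: "'a set \<Rightarrow> ('a \<Rightarrow> bool) set \<Rightarrow> bool" where
  "total_class_on X H \<longleftrightarrow> (\<forall>h\<in>H. \<forall>x. x \<notin> X \<longrightarrow> h x = False)"

definition as_partial :: "('a \<Rightarrow> bool) set \<Rightarrow> 'a pconcept set" where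
  "as_partial H = (\<lambda>h x. Some (h x)) ` H"

definition shatters :: "'a pconcept set \<Rightarrow> 'a set \<Rightarrow> bool" where
  "shatters H S \<longleftrightarrow> finite S \<and>
     (\<forall>y :: 'a \<Rightarrow> bool. \<exists>h\<in>H. \<forall>x\<in>S. h x = Some (y x))"

definition VC :: "'a set \<Rightarrow> 'a pconcept set \<Rightarrow> enat" where
  "VC X H = Sup {enat (card S) | S. S \<subseteq> X \<and> shatters H S}"

text \<open>Mistake trees of height d: internal nodes are indexed by bool lists of
  length < d (root = [], children of v are v@[False], v@[True]), labelled by
  points of X.\<close>
definition shatters_tree :: "'a set \<Rightarrow> 'a pconcept set \<Rightarrow> nat \<Rightarrow> (bool list \<Rightarrow> 'a) \<Rightarrow> bool" where
  "shatters_tree X H d t \<longleftrightarrow>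
     (\<forall>v. length v < d \<longrightarrow> t v \<in> X) \<and>
     (\<forall>y :: bool list. length y = d \<longrightarrow>
        (\<exists>h\<in>H. \<forall>i<d. h (t (take i y)) = Some (y ! i)))"

definition LD :: "'a set \<Rightarrow> 'a pconcept set \<Rightarrow> enat" where
  "LD X H = Sup {enat d | d. \<exists>t. shatters_tree X H d t}"

definition disambiguation :: "'a set \<Rightarrow> 'a pconcept set \<Rightarrow> ('a \<Rightarrow> bool) set \<Rightarrow> bool" where
  "disambiguation X H Hb \<longleftrightarrow> total_class_on X Hb \<and>
     (\<forall>h\<in>H. \<forall>S. finite S \<and> S \<subseteq> X \<and> S \<subseteq> {x. h x \<noteq> None} \<longrightarrow>
        (\<exists>hb\<in>Hb. \<forall>x\<in>S. h x = Some (hb x)))"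

end

theory Submission
  imports Defs
begin

text \<open>Suppose that at most one \<open>h \<in> H\<close> has prescribed values 0 at \<open>p\<close> and 1 at \<open>q\<close>. Then no mistake tree of
  depth 3 is shattered, since its root and the child along 0 already determine \<open>h\<close> on the branch 0, 1.

  Such classes come from unambiguous DNFs, lifted by the indexing gadget: a point is a pair \<open>(x, y)\<close> for
  which cell \<open>i\<close> has the value \<open>y (i, x i) = 0\<close>, and a concept is a term of the DNF together with a guess
  \<open>a\<close> of \<open>x\<close> on its cells. It is 0 where the guess is right and 1 where \<open>y\<close> satisfies the term along \<open>a\<close>.
  A disambiguation colours the points (by the values of all completed concepts) so that no concept takes
  the values 0 and 1 on points of the same colour. If the DNF has width \<open>w\<close> while certifying that the zero
  input violates it takes \<open>t\<close> cells, then there are only \<open>r ^ O(w)\<close> concepts but at least \<open>r ^ t\<close> colours are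
  needed. By Sauer--Shelah with the roles of points and concepts exchanged, the concepts are shattered in
  the dual sense to order \<open>t / w\<close>, and hence points are shattered to order \<open>log (t / w)\<close>. An explicit DNF with
  \<open>w = 9 s\<^sup>6\<close>, \<open>t = s\<^sup>8\<close> and polynomially many cells gives the bound \<open>log log n\<close>.\<close>

section \<open>Dual Sauer--Shelah\<close>

text \<open>Induction on the ground set. Removing \<open>z\<close> splits \<open>F\<close> into its
  projection \<open>F0\<close> to \<open>R\<close> and the family \<open>F1\<close> of those sets
  both of whose extensions lie in \<open>F\<close>, with \<open>card F = card F0 + card F1\<close>.
  A set shattered by \<open>F0\<close> is shattered by \<open>F\<close>, and a set shattered by
  \<open>F1\<close> stays shattered by \<open>F\<close> after \<open>z\<close> is added; membership
  of \<open>z\<close> keeps the two kinds apart.\<close>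

lemma pajor:
  assumes "finite R" "F \<subseteq> Pow R"
  shows "card F \<le> card {S. S \<subseteq> R \<and> (\<forall>B\<subseteq>S. \<exists>A\<in>F. A \<inter> S = B)}"
  using assms
proof (induction R arbitrary: F rule: finite_induct)
  case empty
  show ?case
  proof (cases "F = {}")
    case False
    with empty have "F = {{}}" by auto
    then have "{S. S \<subseteq> {} \<and> (\<forall>B\<subseteq>S. \<exists>A\<in>F. A \<inter> S = B)} = {{}::'a set}" by auto
    with \<open>F = {{}}\<close> show ?thesis by simp
  qed simp
next
  case (insert z R)
  define F0 where "F0 = {A. A \<subseteq> R \<and> (A \<in> F \<or> insert z A \<in> F)}"
  define F1 where "F1 = {A. A \<subseteq> R \<and> A \<in> F \<and> insert z A \<in> F}"
  define sh where "sh F R = {S. S \<subseteq> R \<and> (\<forall>B\<subseteq>S. \<exists>A\<in>F. A \<inter> S = B)}"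
    for F and R :: "'a set"
  have finPow: "finite (Pow (insert z R))" using insert by simp
  have fin: "finite F0" "finite F1" "finite F"
    using insert finPow by (auto simp: F0_def F1_def intro: finite_subset[of _ "Pow (insert z R)"])
  define Fa where "Fa = {A \<in> F. z \<notin> A}"
  define Fb where "Fb = (\<lambda>A. A - {z}) ` {A \<in> F. z \<in> A}"
  have inj: "inj_on (\<lambda>A. A - {z}) {A \<in> F. z \<in> A}" by (auto simp: inj_on_def)
  have "F = Fa \<union> {A \<in> F. z \<in> A}" "Fa \<inter> {A \<in> F. z \<in> A} = {}" by (auto simp: Fa_def)
  then have "card F = card Fa + card {A \<in> F. z \<in> A}"
    by (metis card_Un_disjoint fin(3) finite_Un)
  also have "card {A \<in> F. z \<in> A} = card Fb" unfolding Fb_def using inj by (simp add: card_image)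
  also have "card Fa + card Fb = card (Fa \<union> Fb) + card (Fa \<inter> Fb)"
    by (rule card_Un_Int) (use fin in \<open>auto simp: Fa_def Fb_def\<close>)
  also have "Fa \<union> Fb = F0"
  proof -
    have "A \<in> F0" if "A \<in> Fa" for A using that insert by (auto simp: Fa_def F0_def)
    moreover have "A \<in> F0" if "A \<in> Fb" for A
      using that insert by (auto simp: Fb_def F0_def insert_absorb)
    moreover have "A \<in> Fa \<union> Fb" if "A \<in> F0" for A
    proof (cases "A \<in> F")
      case True then show ?thesis using that insert by (auto simp: Fa_def F0_def)
    next
      case False
      then have "insert z A \<in> F" "z \<notin> A" using that insert by (auto simp: F0_def)
      then have "insert z A \<in> {A \<in> F. z \<in> A}" "A = insert z A - {z}" by auto
      then show ?thesis unfolding Fb_def by blast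
    qed
    ultimately show ?thesis by blast
  qed
  also have "Fa \<inter> Fb = F1"
  proof -
    have "A \<in> F1" if "A \<in> Fa" "A \<in> Fb" for A
      using that insert by (auto simp: Fa_def Fb_def F1_def insert_absorb)
    moreover have "A \<in> Fa \<inter> Fb" if "A \<in> F1" for A
    proof -
      have "insert z A \<in> {A \<in> F. z \<in> A}" "A = insert z A - {z}" "A \<in> Fa"
        using that insert by (auto simp: F1_def Fa_def)
      then show ?thesis unfolding Fb_def by blast
    qed
    ultimately show ?thesis by blast
  qed
  finally have cardF: "card F = card F0 + card F1" .
  have "F0 \<subseteq> Pow R" "F1 \<subseteq> Pow R" by (auto simp: F0_def F1_def)
  then have le: "card F0 \<le> card (sh F0 R)" "card F1 \<le> card (sh F1 R)"
    unfolding sh_def using insert.IH[of F0] insert.IH[of F1] by simp_all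
  have finsh: "finite (sh G R)" "finite (sh G (insert z R))" for G
    using insert by (auto simp: sh_def)
  have inj2: "inj_on (insert z) (sh F1 R)"
  proof (rule inj_onI)
    fix S S' assume "S \<in> sh F1 R" "S' \<in> sh F1 R" "insert z S = insert z S'"
    moreover from this have "z \<notin> S" "z \<notin> S'" using insert by (auto simp: sh_def)
    ultimately show "S = S'" using insert_ident by metis
  qed
  have disj: "sh F0 R \<inter> insert z ` sh F1 R = {}" using insert by (auto simp: sh_def)
  have sub0: "sh F0 R \<subseteq> sh F (insert z R)"
  proof
    fix S assume "S \<in> sh F0 R"
    then have S: "S \<subseteq> R" "\<And>B. B \<subseteq> S \<Longrightarrow> \<exists>A\<in>F0. A \<inter> S = B" by (simp_all add: sh_def)
    have "z \<notin> S" using S(1) insert.hyps by blast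
    have "\<exists>A\<in>F. A \<inter> S = B" if B: "B \<subseteq> S" for B
    proof -
      obtain A where A: "A \<in> F0" "A \<inter> S = B" using S(2)[OF B] by blast
      have "insert z A \<inter> S = B" using A \<open>z \<notin> S\<close> by blast
      moreover have "A \<in> F \<or> insert z A \<in> F" using A by (simp add: F0_def)
      ultimately show ?thesis using A(2) by blast
    qed
    then show "S \<in> sh F (insert z R)" using S(1) by (simp add: sh_def subset_insertI2)
  qed
  have sub1: "insert z ` sh F1 R \<subseteq> sh F (insert z R)"
  proof
    fix S' assume "S' \<in> insert z ` sh F1 R"
    then obtain S where S: "S' = insert z S" "S \<subseteq> R"
        "\<And>B. B \<subseteq> S \<Longrightarrow> \<exists>A\<in>F1. A \<inter> S = B"
      by (auto simp only: sh_def mem_Collect_eq image_iff)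
    have "z \<notin> S" using S(2) insert.hyps by blast
    have "\<exists>A\<in>F. A \<inter> S' = B" if "B \<subseteq> S'" for B
    proof -
      have "B - {z} \<subseteq> S" using that S(1) by blast
      then obtain A where A: "A \<in> F1" "A \<inter> S = B - {z}" using S(3) by blast
      then have A': "A \<in> F" "insert z A \<in> F" "z \<notin> A"
        using insert.hyps by (auto simp: F1_def)
      show ?thesis
      proof (cases "z \<in> B")
        case True
        then have "insert z A \<inter> S' = B" using A(2) S(1) by blast
        then show ?thesis using A' by blast
      next
        case False
        then have "A \<inter> S' = B" using A(2) S(1) A'(3) by blast
        then show ?thesis using A' by blast
      qed
    qed
    then show "S' \<in> sh F (insert z R)" using S(1,2) by (auto simp: sh_def)
  qed
  have "card F \<le> card (sh F0 R) + card (insert z ` sh F1 R)"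
    using cardF le card_image[OF inj2] by simp
  also have "\<dots> = card (sh F0 R \<union> insert z ` sh F1 R)"
    using disj finsh by (simp add: card_Un_disjoint)
  also have "\<dots> \<le> card (sh F (insert z R))"
    using sub0 sub1 finsh by (intro card_mono) auto
  finally show ?case by (simp add: sh_def)
qed

text \<open>A crude substitute for the binomial sum: a set with fewer than \<open>d\<close> elements
  is listed in \<open>d\<close> slots, \<open>None\<close> filling the slots left over, so every
  slot has \<open>card R + 1\<close> choices.\<close>

lemma card_small_subsets:
  assumes "finite R"
  shows "card {S. S \<subseteq> R \<and> card S < d} \<le> (card R + 1) ^ d"
proof -
  let ?G = "{..<d} \<rightarrow>\<^sub>E insert None (Some ` R)"
  have "{S. S \<subseteq> R \<and> card S < d} \<subseteq> (\<lambda>f. {x. Some x \<in> f ` {..<d}}) ` ?G"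
  proof
    fix S assume "S \<in> {S. S \<subseteq> R \<and> card S < d}"
    then have S: "S \<subseteq> R" "card S < d" by auto
    then have "finite S" using assms finite_subset by blast
    then obtain e where e: "bij_betw e {..<card S} S"
      by (metis ex_bij_betw_nat_finite atLeast0LessThan)
    define f where "f = (\<lambda>i\<in>{..<d}. if i < card S then Some (e i) else None)"
    have eS: "e ` {..<card S} = S" using e by (simp add: bij_betw_def)
    then have "e i \<in> R" if "i < card S" for i using that S by blast
    then have "f \<in> ?G" by (auto simp: f_def)
    moreover have "{x. Some x \<in> f ` {..<d}} = S"
    proof (intro set_eqI iffI)
      fix x assume "x \<in> {x. Some x \<in> f ` {..<d}}"
      then obtain i where "i < d" "Some x = f i" by auto
      then have "i < card S" "x = e i" by (auto simp: f_def split: if_splits)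
      then show "x \<in> S" using eS by auto
    next
      fix x assume "x \<in> S"
      then obtain i where "i < card S" "x = e i" using eS by auto
      then have "f i = Some x" "i < d" using S by (auto simp: f_def)
      then show "x \<in> {x. Some x \<in> f ` {..<d}}" by (metis (mono_tags) imageI lessThan_iff mem_Collect_eq)
    qed
    ultimately show "S \<in> (\<lambda>f. {x. Some x \<in> f ` {..<d}}) ` ?G" by blast
  qed
  then have "card {S. S \<subseteq> R \<and> card S < d} \<le> card ?G"
    by (rule surj_card_le[rotated]) (use assms in \<open>auto intro: finite_PiE\<close>)
  also have "\<dots> = (card R + 1) ^ d"
    using assms by (simp add: card_PiE card_insert_if card_image image_iff)
  finally show ?thesis .
qed

text \<open>View \<open>f\<close> as a matrix with rows \<open>R\<close> and columns
  \<open>P\<close>. Pajor's bound for the distinct columns yields at least \<open>2 ^ d\<close> rows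
  on which the columns realise every pattern. Labelling \<open>2 ^ d\<close> of them by the subsets
  \<open>V\<close> of \<open>{..<d}\<close> and choosing for each \<open>b\<close> a column that
  marks exactly the rows with \<open>b\<close> in \<open>V\<close> exchanges the roles of rows and
  columns.\<close>

lemma shattered_of_many_columns:
  fixes f :: "'h \<Rightarrow> 'p \<Rightarrow> bool"
  assumes R: "finite R"
    and many: "(card R + 1) ^ 2 ^ d < card ((\<lambda>p. {h \<in> R. f h p}) ` P)"
  obtains S where "S \<subseteq> P" "finite S" "card S = d" "\<forall>y. \<exists>h\<in>R. \<forall>p\<in>S. f h p = y p"
proof -
  let ?F = "(\<lambda>p. {h \<in> R. f h p}) ` P"
  define Sh where "Sh = {S. S \<subseteq> R \<and> (\<forall>B\<subseteq>S. \<exists>A\<in>?F. A \<inter> S = B)}"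
  define Sm where "Sm = {S. S \<subseteq> R \<and> card S < 2 ^ d}"
  have "card ?F \<le> card Sh" unfolding Sh_def using R by (intro pajor) auto
  then have "card Sm < card Sh"
    using card_small_subsets[OF R, of "2 ^ d"] many unfolding Sm_def by linarith
  moreover have "finite Sm" using R by (simp add: Sm_def)
  ultimately have "\<not> Sh \<subseteq> Sm"
    using card_mono leD by metis
  then obtain W where "W \<in> Sh" "W \<notin> Sm" by blast
  then have W: "W \<subseteq> R" "\<And>B. B \<subseteq> W \<Longrightarrow> \<exists>A\<in>?F. A \<inter> W = B" "2 ^ d \<le> card W"
    unfolding Sh_def Sm_def by (blast, blast, simp)
  have "card (Pow {..<d}) \<le> card W" using W(3) by (simp add: card_Pow)
  then obtain e where e: "inj_on e (Pow {..<d})" "e ` Pow {..<d} \<subseteq> W"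
    using card_le_inj[of "Pow {..<d}" W] finite_subset[OF W(1) R] by auto
  have "\<exists>p\<in>P. {h \<in> R. f h p} \<inter> W = e ` {V \<in> Pow {..<d}. b \<in> V}" for b
  proof -
    have "e ` {V \<in> Pow {..<d}. b \<in> V} \<subseteq> W" using e(2) by blast
    from W(2)[OF this] show ?thesis by (simp only: bex_simps)
  qed
  then obtain p where p: "\<And>b. p b \<in> P"
      "\<And>b. {h \<in> R. f h (p b)} \<inter> W = e ` {V \<in> Pow {..<d}. b \<in> V}"
    by metis
  have fe: "f (e V) (p b) \<longleftrightarrow> b \<in> V" if "V \<subseteq> {..<d}" for V b
  proof -
    have "e V \<in> W" "e V \<in> R" using e(2) that W(1) by blast+
    then have "f (e V) (p b) \<longleftrightarrow> e V \<in> {h \<in> R. f h (p b)} \<inter> W" by auto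
    also have "\<dots> \<longleftrightarrow> b \<in> V" unfolding p(2) using e that by (auto simp: inj_on_def)
    finally show ?thesis .
  qed
  have inj: "inj_on p {..<d}"
  proof (rule inj_onI)
    fix a b assume "a \<in> {..<d}" "b \<in> {..<d}" "p a = p b"
    then have "f (e {a}) (p b)" using fe[of "{a}" a] by simp
    then show "a = b" using fe[of "{a}" b] \<open>a \<in> {..<d}\<close> by simp
  qed
  show ?thesis
  proof
    show "p ` {..<d} \<subseteq> P" "finite (p ` {..<d})" using p by auto
    show "card (p ` {..<d}) = d" using inj by (simp add: card_image)
    show "\<forall>y. \<exists>h\<in>R. \<forall>x\<in>p ` {..<d}. f h x = y x"
    proof
      fix y
      let ?V = "{b. b < d \<and> y (p b)}"
      have "?V \<subseteq> {..<d}" by auto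
      then have "e ?V \<in> R" using e(2) W(1) by blast
      moreover have "f (e ?V) (p b) = y (p b)" if "b < d" for b
        using fe[OF \<open>?V \<subseteq> {..<d}\<close>, of b] that by simp
      ultimately show "\<exists>h\<in>R. \<forall>x\<in>p ` {..<d}. f h x = y x" by blast
    qed
  qed
qed

section \<open>Spread families\<close>

text \<open>Blockwise min-entropy of the uniform distribution on \<open>X\<close>: every further
  prescribed coordinate in \<open>D\<close> costs at least a factor \<open>r\<close>.\<close>

definition spread :: "nat \<Rightarrow> 'i set \<Rightarrow> ('i \<Rightarrow> nat) set \<Rightarrow> bool" where
  "spread r D X \<longleftrightarrow> finite X \<and> X \<noteq> {} \<and>
     (\<forall>J b. J \<subseteq> D \<longrightarrow> r ^ card J * card {x \<in> X. \<forall>i\<in>J. x i = b i} \<le> card X)"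

lemma sum_power_card_Pow:
  fixes c :: real
  assumes "finite D"
  shows "(\<Sum>J\<in>Pow D. c ^ card J) = (1 + c) ^ card D"
  using prod_add[OF assms, of "\<lambda>_. c" "\<lambda>_. 1"] by (simp add: add.commute)

text \<open>This is the correlation term of the second moment. The power for the agreement set is
  one summand of the sum over all subsets \<open>J\<close> of that set. Spreadness bounds the
  fraction of pairs agreeing on \<open>J\<close> by \<open>1 / r ^ card J\<close>, and what remains
  is \<open>(1 + a / r) ^ card D\<close>, at most \<open>exp (1 / 2)\<close>.\<close>

lemma spread_pair_sum:
  fixes a :: nat
  assumes X: "spread r D X" and D: "finite D" "card D \<le> w" and r: "2 * a * w \<le> r" "0 < r"
  shows "(\<Sum>x\<in>X. \<Sum>x'\<in>X. real a ^ card {i\<in>D. x i = x' i}) \<le> 2 * (real (card X))\<^sup>2"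
proof -
  have fin: "finite X" using X by (simp add: spread_def)
  have "(\<Sum>x\<in>X. \<Sum>x'\<in>X. real a ^ card {i\<in>D. x i = x' i})
      \<le> (\<Sum>x\<in>X. \<Sum>x'\<in>X. \<Sum>J\<in>Pow D. if \<forall>i\<in>J. x i = x' i then real a ^ card J else 0)"
  proof (intro sum_mono)
    fix x x' :: "'a \<Rightarrow> nat"
    let ?f = "\<lambda>J. if \<forall>i\<in>J. x i = x' i then real a ^ card J else 0"
    have "?f {i\<in>D. x i = x' i} \<le> (\<Sum>J\<in>Pow D. ?f J)"
      by (rule member_le_sum) (use D in auto)
    then show "real a ^ card {i\<in>D. x i = x' i} \<le> (\<Sum>J\<in>Pow D. ?f J)" by simp
  qed
  also have "\<dots> = (\<Sum>x\<in>X. \<Sum>J\<in>Pow D. \<Sum>x'\<in>X. if \<forall>i\<in>J. x i = x' i then real a ^ card J else 0)"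
    by (intro sum.cong refl sum.swap)
  also have "\<dots> = (\<Sum>x\<in>X. \<Sum>J\<in>Pow D. real a ^ card J * card {x' \<in> X. \<forall>i\<in>J. x' i = x i})"
    using fin by (intro sum.cong refl) (simp add: sum.If_cases Int_def mult.commute eq_commute)
  also have "\<dots> \<le> (\<Sum>x\<in>X. \<Sum>J\<in>Pow D. real a ^ card J * (card X / real r ^ card J))"
  proof (intro sum_mono mult_left_mono)
    fix x and J assume "J \<in> Pow D"
    then have "r ^ card J * card {x' \<in> X. \<forall>i\<in>J. x' i = x i} \<le> card X"
      using X unfolding spread_def by blast
    then have "real (r ^ card J * card {x' \<in> X. \<forall>i\<in>J. x' i = x i}) \<le> real (card X)"
      by (rule of_nat_mono)
    then show "real (card {x' \<in> X. \<forall>i\<in>J. x' i = x i}) \<le> card X / real r ^ card J"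
      using r by (simp add: field_simps)
  qed simp
  also have "\<dots> = (real (card X))\<^sup>2 * (\<Sum>J\<in>Pow D. (real a / real r) ^ card J)"
    by (simp add: sum_distrib_left power_divide power2_eq_square field_simps)
  finally have le: "(\<Sum>x\<in>X. \<Sum>x'\<in>X. real a ^ card {i\<in>D. x i = x' i})
      \<le> (real (card X))\<^sup>2 * (\<Sum>J\<in>Pow D. (real a / real r) ^ card J)" .
  have "(\<Sum>J\<in>Pow D. (real a / real r) ^ card J) = (1 + real a / real r) ^ card D"
    by (rule sum_power_card_Pow) (rule D)
  also have "\<dots> \<le> exp (real a / real r) ^ card D"
    by (intro power_mono exp_ge_add_one_self) auto
  also have "\<dots> = exp (card D * (real a / real r))" by (rule exp_of_nat_mult[symmetric])
  also have "\<dots> \<le> exp (1 / 2)"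
  proof -
    have "2 * a * card D \<le> r" using D(2) r(1) by (meson le_trans mult_le_mono2)
    then have "real (2 * a * card D) \<le> real r" by (rule of_nat_mono)
    then show ?thesis using r by (simp add: field_simps)
  qed
  also have "\<dots> \<le> (2::real)" by (rule exp_half_le2)
  finally show ?thesis using le mult_left_mono[of _ 2 "(real (card X))\<^sup>2"] by fastforce
qed

text \<open>For uniform \<open>\<omega>\<close> every position is hit independently with probability
  \<open>1 / a\<close>. Let \<open>Z\<close> count the members of \<open>X\<close> whose graph over
  \<open>D\<close> is hit entirely. Two graphs share as many positions as their functions have
  agreements, so \<open>spread_pair_sum\<close> bounds the second moment of \<open>Z\<close> by
  twice the square of its mean, and Cauchy--Schwarz makes \<open>Z\<close> positive with probability
  at least 1/2.\<close>

lemma second_moment_hit: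
  fixes hit :: "'o \<Rightarrow> 'i \<times> nat \<Rightarrow> bool"
  assumes X: "spread r D X" and D: "finite D" "card D \<le> w" and r: "2 * a * w \<le> r" "0 < r"
    and \<Omega>: "finite \<Omega>"
    and U: "\<And>x i. x \<in> X \<Longrightarrow> i \<in> D \<Longrightarrow> (i, x i) \<in> U"
    and indep: "\<And>W. W \<subseteq> U \<Longrightarrow> card {\<omega>\<in>\<Omega>. \<forall>u\<in>W. hit \<omega> u} * a ^ card W = card \<Omega>"
    and a: "0 < a"
  shows "card \<Omega> \<le> 2 * card {\<omega>\<in>\<Omega>. \<exists>x\<in>X. \<forall>i\<in>D. hit \<omega> (i, x i)}"
proof -
  define gr where "gr x = (\<lambda>i. (i, x i)) ` D" for x :: "'i \<Rightarrow> nat"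
  define Z where "Z \<omega> = card {x\<in>X. \<forall>u\<in>gr x. hit \<omega> u}" for \<omega>
  define H where "H = {\<omega>\<in>\<Omega>. \<exists>x\<in>X. \<forall>i\<in>D. hit \<omega> (i, x i)}"
  define n where "n = card \<Omega>"
  have fin: "finite X" "X \<noteq> {}" using X by (auto simp: spread_def)
  have gr: "finite (gr x)" "card (gr x) = card D" "x \<in> X \<Longrightarrow> gr x \<subseteq> U" for x
    using D U by (auto simp: gr_def card_image inj_on_def)
  have cnt: "real (card {\<omega>\<in>\<Omega>. \<forall>u\<in>W. hit \<omega> u}) = n / real a ^ card W" if "W \<subseteq> U" for W
    using arg_cong[OF indep[OF that], of real] a by (simp add: n_def field_simps)
  have Zsum: "real (Z \<omega>) = (\<Sum>x\<in>X. if \<forall>u\<in>gr x. hit \<omega> u then 1 else 0)" for \<omega>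
    using fin by (simp add: Z_def sum.If_cases Int_def)
  have "(\<Sum>\<omega>\<in>\<Omega>. real (Z \<omega>)) = (\<Sum>x\<in>X. \<Sum>\<omega>\<in>\<Omega>. if \<forall>u\<in>gr x. hit \<omega> u then 1 else 0)"
    unfolding Zsum by (rule sum.swap)
  also have "\<dots> = (\<Sum>x\<in>X. n / real a ^ card D)"
  proof (rule sum.cong[OF refl])
    fix x assume "x \<in> X"
    have "(\<Sum>\<omega>\<in>\<Omega>. if \<forall>u\<in>gr x. hit \<omega> u then 1 else 0) = real (card {\<omega>\<in>\<Omega>. \<forall>u\<in>gr x. hit \<omega> u})"
      using \<Omega> by (simp add: sum.If_cases Int_def)
    also have "\<dots> = n / real a ^ card D" using cnt[OF gr(3)[OF \<open>x \<in> X\<close>]] gr by simp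
    finally show "(\<Sum>\<omega>\<in>\<Omega>. if \<forall>u\<in>gr x. hit \<omega> u then 1 else 0) = n / real a ^ card D" .
  qed
  finally have EZ: "(\<Sum>\<omega>\<in>\<Omega>. real (Z \<omega>)) = card X * (n / real a ^ card D)" by simp
  have "(\<Sum>\<omega>\<in>\<Omega>. (real (Z \<omega>))\<^sup>2)
      = (\<Sum>\<omega>\<in>\<Omega>. \<Sum>x\<in>X. \<Sum>x'\<in>X. if \<forall>u\<in>gr x \<union> gr x'. hit \<omega> u then 1 else 0)"
    unfolding Zsum power2_eq_square sum_product
    by (intro sum.cong refl) (auto simp: ball_Un)
  also have "\<dots> = (\<Sum>x\<in>X. \<Sum>\<omega>\<in>\<Omega>. \<Sum>x'\<in>X. if \<forall>u\<in>gr x \<union> gr x'. hit \<omega> u then 1 else 0)"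
    by (rule sum.swap)
  also have "\<dots> = (\<Sum>x\<in>X. \<Sum>x'\<in>X. \<Sum>\<omega>\<in>\<Omega>. if \<forall>u\<in>gr x \<union> gr x'. hit \<omega> u then 1 else 0)"
    by (intro sum.cong refl sum.swap)
  also have "\<dots> = (\<Sum>x\<in>X. \<Sum>x'\<in>X. n / real a ^ (2 * card D) * real a ^ card {i\<in>D. x i = x' i})"
  proof (intro sum.cong refl)
    fix x x' assume x: "x \<in> X" "x' \<in> X"
    have sub: "gr x \<union> gr x' \<subseteq> U" using gr(3) x by auto
    have "gr x \<inter> gr x' = (\<lambda>i. (i, x i)) ` {i\<in>D. x i = x' i}" by (auto simp: gr_def)
    then have "card (gr x \<inter> gr x') = card {i\<in>D. x i = x' i}"
      by (simp add: card_image inj_on_def)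
    then have c: "card (gr x \<union> gr x') + card {i\<in>D. x i = x' i} = 2 * card D"
      using card_Un_Int[OF gr(1)[of x] gr(1)[of x']] gr(2)[of x] gr(2)[of x'] by linarith
    have "(\<Sum>\<omega>\<in>\<Omega>. if \<forall>u\<in>gr x \<union> gr x'. hit \<omega> u then 1 else 0)
        = real (card {\<omega>\<in>\<Omega>. \<forall>u\<in>gr x \<union> gr x'. hit \<omega> u})"
      using \<Omega> by (simp add: sum.If_cases Int_def)
    also have "\<dots> = n / real a ^ card (gr x \<union> gr x')" by (rule cnt[OF sub])
    also have "\<dots> = n / real a ^ (2 * card D) * real a ^ card {i\<in>D. x i = x' i}"
      unfolding c[symmetric] using a by (simp add: power_add)
    finally show "(\<Sum>\<omega>\<in>\<Omega>. if \<forall>u\<in>gr x \<union> gr x'. hit \<omega> u then 1 else 0)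
        = n / real a ^ (2 * card D) * real a ^ card {i\<in>D. x i = x' i}" .
  qed
  also have "\<dots> = n / real a ^ (2 * card D) * (\<Sum>x\<in>X. \<Sum>x'\<in>X. real a ^ card {i\<in>D. x i = x' i})"
    by (simp add: sum_distrib_left)
  also have "\<dots> \<le> n / real a ^ (2 * card D) * (2 * (real (card X))\<^sup>2)"
    by (intro mult_left_mono spread_pair_sum[OF X D r]) simp
  finally have EZ2: "(\<Sum>\<omega>\<in>\<Omega>. (real (Z \<omega>))\<^sup>2) \<le> n / real a ^ (2 * card D) * (2 * (real (card X))\<^sup>2)" .
  have Z0: "Z \<omega> = 0" if "\<omega> \<in> \<Omega> - H" for \<omega>
  proof -
    have "{x\<in>X. \<forall>u\<in>gr x. hit \<omega> u} = {}" using that by (auto simp: H_def gr_def)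
    then show ?thesis unfolding Z_def by (simp only: card.empty)
  qed
  have HO: "finite H" "H \<subseteq> \<Omega>" using \<Omega> by (auto simp: H_def)
  \<comment> \<open>Cauchy--Schwarz for \<open>Z\<close> and the indicator of its support
    \<open>H\<close>.\<close>
  have "(\<Sum>\<omega>\<in>\<Omega>. real (Z \<omega>))\<^sup>2 = (\<Sum>\<omega>\<in>H. 1 * real (Z \<omega>))\<^sup>2"
    using sum.mono_neutral_right[OF \<Omega> HO(2), of "\<lambda>\<omega>. real (Z \<omega>)"] Z0 by simp
  also have "\<dots> \<le> (\<Sum>\<omega>\<in>H. 1\<^sup>2) * (\<Sum>\<omega>\<in>H. (real (Z \<omega>))\<^sup>2)"
    by (rule Cauchy_Schwarz_ineq_sum)
  also have "\<dots> \<le> card H * (\<Sum>\<omega>\<in>\<Omega>. (real (Z \<omega>))\<^sup>2)"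
    using HO \<Omega> by (auto intro!: mult_left_mono sum_mono2)
  also have "\<dots> \<le> card H * (n / real a ^ (2 * card D) * (2 * (real (card X))\<^sup>2))"
    by (intro mult_left_mono EZ2) simp
  finally have "(card X * (n / real a ^ card D))\<^sup>2
      \<le> card H * (n / real a ^ (2 * card D) * (2 * (real (card X))\<^sup>2))"
    unfolding EZ .
  then have "(real (card X))\<^sup>2 / real a ^ (2 * card D) * (real n * real n)
      \<le> (real (card X))\<^sup>2 / real a ^ (2 * card D) * (2 * card H * real n)"
    by (simp add: power2_eq_square power_mult power_mult_distrib power_divide field_simps power_even_eq)
  moreover have "0 < (real (card X))\<^sup>2 / real a ^ (2 * card D)"
    using fin a by (simp add: card_gt_0_iff)
  ultimately have "real n * real n \<le> 2 * card H * real n"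
    using mult_le_cancel_left_pos by blast
  then have "real n \<le> 2 * card H" by (cases "n = 0") auto
  then show ?thesis by (simp add: n_def H_def)
qed

lemma card_PiE_prescribed:
  assumes "finite U" "W \<subseteq> U" "j < k"
  shows "card {c \<in> U \<rightarrow>\<^sub>E {..<k::nat}. \<forall>u\<in>W. c u = j} * k ^ card W = k ^ card U"
proof -
  have "{c \<in> U \<rightarrow>\<^sub>E {..<k}. \<forall>u\<in>W. c u = j} = PiE U (\<lambda>u. if u \<in> W then {j} else {..<k})"
  proof (intro set_eqI iffI)
    fix c assume "c \<in> {c \<in> U \<rightarrow>\<^sub>E {..<k}. \<forall>u\<in>W. c u = j}"
    then show "c \<in> PiE U (\<lambda>u. if u \<in> W then {j} else {..<k})" by (auto simp: PiE_iff)
  next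
    fix c assume c: "c \<in> PiE U (\<lambda>u. if u \<in> W then {j} else {..<k})"
    have "c u = j" if "u \<in> W" for u using PiE_mem[OF c, of u] that assms(2) by auto
    moreover have "c u < k" if "u \<in> U" for u
      using PiE_mem[OF c that] assms(3) by (auto split: if_splits)
    moreover have "c \<in> extensional U" using c by (simp add: PiE_def)
    ultimately show "c \<in> {c \<in> U \<rightarrow>\<^sub>E {..<k}. \<forall>u\<in>W. c u = j}" by (simp add: PiE_iff)
  qed
  then have "card {c \<in> U \<rightarrow>\<^sub>E {..<k}. \<forall>u\<in>W. c u = j} = (\<Prod>u\<in>U. if u \<in> W then 1 else k)"
    using assms(1) by (simp add: card_PiE if_distrib cong: if_cong)
  also have "\<dots> = k ^ card (U - W)"
    using assms by (simp add: prod.If_cases Diff_eq)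
  finally show ?thesis
    using assms by (simp add: card_Diff_subset finite_subset card_mono flip: power_add)
qed

lemma card_Pow_prescribed:
  assumes "finite U" "W \<subseteq> U"
  shows "card {y \<in> Pow U. \<forall>u\<in>W. u \<in> y \<longleftrightarrow> u \<in> V} * 2 ^ card W = 2 ^ card U"
proof -
  have "{y \<in> Pow U. \<forall>u\<in>W. u \<in> y \<longleftrightarrow> u \<in> V} = (\<lambda>z. z \<union> (V \<inter> W)) ` Pow (U - W)"
  proof (intro set_eqI iffI)
    fix y assume y: "y \<in> {y \<in> Pow U. \<forall>u\<in>W. u \<in> y \<longleftrightarrow> u \<in> V}"
    then have "y = (y - W) \<union> (V \<inter> W)" "y - W \<in> Pow (U - W)" by blast+
    then show "y \<in> (\<lambda>z. z \<union> (V \<inter> W)) ` Pow (U - W)" by blast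
  qed (use assms in auto)
  moreover have "inj_on (\<lambda>z. z \<union> (V \<inter> W)) (Pow (U - W))" by (rule inj_onI) blast
  ultimately have "card {y \<in> Pow U. \<forall>u\<in>W. u \<in> y \<longleftrightarrow> u \<in> V} = 2 ^ card (U - W)"
    using assms by (simp add: card_image card_Pow)
  then show ?thesis
    using assms by (simp add: card_Diff_subset finite_subset card_mono flip: power_add)
qed

text \<open>Colour the positions at random with \<open>k\<close> colours. By the second moment method a spread family
  contains, for each colour separately, a member of that colour that fits with probability at least
  1/2, and for a fixed colouring these \<open>k\<close> events are independent.\<close>

lemma card_no_fit:
  fixes X :: "('i \<Rightarrow> nat) set" and k :: nat
  assumes X: "spread r D X" and D: "finite D" "card D \<le> w" and r: "4 * k * w \<le> r" "0 < r"
    and k: "0 < k" and U: "finite U" "\<And>x i. x \<in> X \<Longrightarrow> i \<in> D \<Longrightarrow> (i, x i) \<in> U"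
  shows "card {y \<in> Pow U. \<forall>x\<in>X. \<not> (\<forall>i\<in>D. (i, x i) \<in> y \<longleftrightarrow> i \<in> p)} * exp (k / 2) \<le> 2 ^ card U"
proof -
  define C where "C = U \<rightarrow>\<^sub>E {..<k}"
  \<comment> \<open>A position has colour \<open>j\<close> and the bit that a fitting table requires
    with probability \<open>1 / (2 * k)\<close>. So the second moment bound is used with
    \<open>a = 2 * k\<close>, which is the reason for \<open>4 * k * w\<close> in the
    hypothesis.\<close>
  define hit where "hit j \<omega> u \<longleftrightarrow> fst \<omega> u = j \<and> (u \<in> snd \<omega> \<longleftrightarrow> fst u \<in> p)"
    for j and \<omega> :: "('i \<times> nat \<Rightarrow> nat) \<times> ('i \<times> nat) set" and u
  define hits where "hits j c y = (\<exists>x\<in>X. \<forall>i\<in>D. hit j (c, y) (i, x i))" for j c y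
  define N where "N j c = card {y \<in> Pow U. \<not> hits j c y}" for j c
  have finC: "finite C" unfolding C_def using U(1) by (simp add: finite_PiE)
  have cardC: "card C = k ^ card U" using U(1) by (simp add: C_def card_PiE)
  have C0: "C \<noteq> {}"
  proof
    assume "C = {}"
    then show False using cardC k by simp
  qed
  have half: "2 * (\<Sum>c\<in>C. N j c) \<le> card C * 2 ^ card U" if j: "j < k" for j
  proof -
    let ?O = "C \<times> Pow U"
    have "card ?O \<le> 2 * card {\<omega>\<in>?O. \<exists>x\<in>X. \<forall>i\<in>D. hit j \<omega> (i, x i)}"
    proof (rule second_moment_hit[OF X D])
      show "2 * (2 * k) * w \<le> r" "0 < r" "0 < 2 * k" using r k by simp_all
      show "finite ?O" using finC U(1) by simp
      show "\<And>x i. x \<in> X \<Longrightarrow> i \<in> D \<Longrightarrow> (i, x i) \<in> U" by (rule U(2))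
      fix W assume W: "W \<subseteq> U"
      have "{\<omega>\<in>?O. \<forall>u\<in>W. hit j \<omega> u}
          = {c \<in> C. \<forall>u\<in>W. c u = j} \<times> {y \<in> Pow U. \<forall>u\<in>W. u \<in> y \<longleftrightarrow> u \<in> {u. fst u \<in> p}}"
        by (auto simp: hit_def)
      then have "card {\<omega>\<in>?O. \<forall>u\<in>W. hit j \<omega> u} * (2 * k) ^ card W
          = (card {c \<in> C. \<forall>u\<in>W. c u = j} * k ^ card W)
            * (card {y \<in> Pow U. \<forall>u\<in>W. u \<in> y \<longleftrightarrow> u \<in> {u. fst u \<in> p}} * 2 ^ card W)"
        by (simp add: card_cartesian_product power_mult_distrib)
      also have "\<dots> = k ^ card U * 2 ^ card U"
        unfolding C_def using card_PiE_prescribed[OF U(1) W j] card_Pow_prescribed[OF U(1) W]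
        by presburger
      finally show "card {\<omega>\<in>?O. \<forall>u\<in>W. hit j \<omega> u} * (2 * k) ^ card W = card ?O"
        using U(1) by (simp add: card_cartesian_product cardC card_Pow)
    qed
    moreover have "card ?O = card {\<omega>\<in>?O. \<exists>x\<in>X. \<forall>i\<in>D. hit j \<omega> (i, x i)} + (\<Sum>c\<in>C. N j c)"
    proof -
      have "(\<Sum>c\<in>C. N j c) = card (SIGMA c:C. {y \<in> Pow U. \<not> hits j c y})"
        unfolding N_def using finC U(1) by (simp add: card_SigmaI)
      moreover have "card ?O = card {\<omega>\<in>?O. \<exists>x\<in>X. \<forall>i\<in>D. hit j \<omega> (i, x i)}
          + card (SIGMA c:C. {y \<in> Pow U. \<not> hits j c y})"
      proof (subst card_Un_disjoint[symmetric])
        show "finite {\<omega>\<in>?O. \<exists>x\<in>X. \<forall>i\<in>D. hit j \<omega> (i, x i)}"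
          "finite (SIGMA c:C. {y \<in> Pow U. \<not> hits j c y})"
          using finC U(1) by auto
      qed (unfold hits_def, blast, rule arg_cong[of _ _ card], blast)
      ultimately show ?thesis by simp
    qed
    ultimately show ?thesis using U(1) by (simp add: card_cartesian_product card_Pow)
  qed
  \<comment> \<open>One colouring has to serve all colours. Averaging controls only the sum of the
    failure probabilities over \<open>j\<close>, not each of them.\<close>
  have "\<exists>c\<in>C. 2 * (\<Sum>j<k. N j c) \<le> k * 2 ^ card U"
  proof (rule ccontr)
    assume "\<not> ?thesis"
    then have "(\<Sum>c\<in>C. k * 2 ^ card U) < (\<Sum>c\<in>C. 2 * (\<Sum>j<k. N j c))"
      using finC C0 by (intro sum_strict_mono) (auto simp: not_le)
    also have "\<dots> = (\<Sum>j<k. 2 * (\<Sum>c\<in>C. N j c))"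
      unfolding sum_distrib_left by (rule sum.swap)
    also have "\<dots> \<le> (\<Sum>j<k. card C * 2 ^ card U)" using half by (intro sum_mono) auto
    finally show False by simp
  qed
  then obtain c where c: "c \<in> C" "2 * (\<Sum>j<k. N j c) \<le> k * 2 ^ card U" by blast
  \<comment> \<open>With \<open>c\<close> fixed, success in colour \<open>j\<close> depends only on
    the bits in \<open>V j\<close>. A bad table therefore splits into independent bad pieces, one in
    each \<open>G j\<close>.\<close>
  define V where "V j = {u \<in> U. c u = j}" for j
  define G where "G j = {z \<in> Pow (V j). \<not> hits j c z}" for j
  define bad where "bad = {y \<in> Pow U. \<forall>x\<in>X. \<not> (\<forall>i\<in>D. (i, x i) \<in> y \<longleftrightarrow> i \<in> p)}"
  have V: "finite (V j)" "V j \<subseteq> U" for j using U(1) by (auto simp: V_def)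
  have hits_cong: "hits j c (y \<inter> V j) \<longleftrightarrow> hits j c y" for j y
  proof -
    have "hit j (c, y \<inter> V j) (i, x i) \<longleftrightarrow> hit j (c, y) (i, x i)" if "x \<in> X" "i \<in> D" for x i
      using U(2)[OF that] by (auto simp: hit_def V_def)
    then show ?thesis unfolding hits_def by (meson bex_cong)
  qed
  have sumV: "(\<Sum>j<k. card (V j)) = card U"
  proof -
    have "(\<Union>j<k. V j) = U" using c(1) by (auto simp: V_def C_def)
    moreover have "card (\<Union>j<k. V j) = (\<Sum>j<k. card (V j))"
      using V by (intro card_UN_disjoint) (auto simp: V_def)
    ultimately show ?thesis by simp
  qed
  have GN: "real (card (G j)) \<le> 2 ^ card (V j) * exp (real (N j c) / 2 ^ card U - 1)" for j
  proof -
    have "(\<lambda>(z, z'). z \<union> z') ` (G j \<times> Pow (U - V j)) \<subseteq> {y \<in> Pow U. \<not> hits j c y}"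
    proof clarify
      fix z z' assume z: "z \<in> G j" "z' \<subseteq> U - V j"
      then have "(z \<union> z') \<inter> V j = z" by (auto simp: G_def)
      then show "z \<union> z' \<in> Pow U \<and> \<not> hits j c (z \<union> z')"
        using z hits_cong[of j "z \<union> z'"] V(2)[of j] by (auto simp: G_def)
    qed
    moreover have "inj_on (\<lambda>(z, z'). z \<union> z') (G j \<times> Pow (U - V j))"
    proof (rule inj_onI, clarify)
      fix a a' b b' assume "a \<in> G j" "a' \<subseteq> U - V j" "b \<in> G j" "b' \<subseteq> U - V j" "a \<union> a' = b \<union> b'"
      moreover from this have "a \<subseteq> V j" "b \<subseteq> V j" by (auto simp: G_def)
      ultimately show "a = b \<and> a' = b'" by blast
    qed
    ultimately have "card (G j \<times> Pow (U - V j)) \<le> N j c"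
      unfolding N_def using U(1) by (intro card_inj_on_le) auto
    then have "card (G j) * 2 ^ card (U - V j) \<le> N j c"
      using U(1) by (simp add: card_cartesian_product card_Pow)
    then have "card (G j) * 2 ^ card (U - V j) * 2 ^ card (V j) \<le> N j c * 2 ^ card (V j)" by simp
    moreover have "(2::nat) ^ card (U - V j) * 2 ^ card (V j) = 2 ^ card U"
      using V U(1) by (simp add: card_Diff_subset card_mono flip: power_add)
    ultimately have "card (G j) * 2 ^ card U \<le> N j c * 2 ^ card (V j)" by (metis mult.assoc)
    then have "real (card (G j) * 2 ^ card U) \<le> real (N j c * 2 ^ card (V j))" by (rule of_nat_mono)
    then have "real (card (G j)) \<le> 2 ^ card (V j) * (real (N j c) / 2 ^ card U)"
      by (simp add: field_simps)
    \<comment> \<open>Replacing a fraction \<open>q\<close> by \<open>exp (q - 1)\<close> makes the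
      product over the colours depend only on the sum of the fractions, which is at most
      \<open>k / 2\<close>.\<close>
    also have "\<dots> \<le> 2 ^ card (V j) * exp (real (N j c) / 2 ^ card U - 1)"
      using exp_ge_add_one_self[of "real (N j c) / 2 ^ card U - 1"] by (intro mult_left_mono) auto
    finally show ?thesis .
  qed
  have "card bad \<le> card (PiE {..<k} G)"
  proof (rule card_inj_on_le)
    show "inj_on (\<lambda>y. \<lambda>j\<in>{..<k}. y \<inter> V j) bad"
    proof (rule inj_onI)
      fix y y' assume y: "y \<in> bad" "y' \<in> bad"
        and eq: "(\<lambda>j\<in>{..<k}. y \<inter> V j) = (\<lambda>j\<in>{..<k}. y' \<inter> V j)"
      have "u \<in> y \<longleftrightarrow> u \<in> y'" if "u \<in> U" for u
      proof -
        have "c u < k" using c(1) that by (auto simp: C_def)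
        then have "y \<inter> V (c u) = y' \<inter> V (c u)" using fun_cong[OF eq, of "c u"] by simp
        then show ?thesis using that by (auto simp: V_def)
      qed
      then show "y = y'" using y by (auto simp: bad_def)
    qed
    show "(\<lambda>y. \<lambda>j\<in>{..<k}. y \<inter> V j) ` bad \<subseteq> PiE {..<k} G"
    proof clarify
      fix y assume y: "y \<in> bad"
      have "\<not> hits j c y" for j
        using y unfolding bad_def hits_def hit_def fst_conv snd_conv by blast
      then have "y \<inter> V j \<in> G j" for j using hits_cong[of j y] by (simp add: G_def)
      then show "(\<lambda>j\<in>{..<k}. y \<inter> V j) \<in> PiE {..<k} G" by simp
    qed
    show "finite (PiE {..<k} G)" using V by (intro finite_PiE) (auto simp: G_def)
  qed
  then have "real (card bad) \<le> (\<Prod>j<k. real (card (G j)))"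
    by (simp add: card_PiE flip: of_nat_prod)
  also have "\<dots> \<le> (\<Prod>j<k. 2 ^ card (V j) * exp (real (N j c) / 2 ^ card U - 1))"
    using GN by (intro prod_mono) auto
  also have "\<dots> = 2 ^ (\<Sum>j<k. card (V j)) * exp (\<Sum>j<k. real (N j c) / 2 ^ card U - 1)"
    by (simp add: prod.distrib power_sum exp_sum)
  also have "(\<Sum>j<k. real (N j c) / 2 ^ card U - 1) = real (\<Sum>j<k. N j c) / 2 ^ card U - k"
    by (simp add: sum_subtractf sum_divide_distrib)
  also have "exp (real (\<Sum>j<k. N j c) / 2 ^ card U - k) \<le> exp (- (k / 2))"
  proof -
    have "real (2 * (\<Sum>j<k. N j c)) \<le> real (k * 2 ^ card U)" using c(2) by (rule of_nat_mono)
    then show ?thesis by (simp add: field_simps)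
  qed
  finally have "real (card bad) \<le> 2 ^ card U * exp (- (k / 2))" by (simp add: sumV)
  then have "real (card bad) * exp (k / 2) \<le> 2 ^ card U * exp (- (k / 2)) * exp (k / 2)"
    by (intro mult_right_mono) auto
  also have "\<dots> = 2 ^ card U" by (simp add: mult.assoc flip: exp_add)
  finally show ?thesis by (simp add: bad_def)
qed

section \<open>Lifting a DNF\<close>

text \<open>The first set holds the variables that occur positively, the second those that occur
  negated.\<close>

type_synonym 'i dnf_term = "'i set \<times> 'i set"
type_synonym 'i point = "('i \<Rightarrow> nat) \<times> ('i \<times> nat) set"

definition cells :: "'i dnf_term \<Rightarrow> 'i set" where
  "cells c = fst c \<union> snd c"

definition unambiguous :: "'i dnf_term set \<Rightarrow> bool" where
  "unambiguous C \<longleftrightarrow> (\<forall>c\<in>C. \<forall>c'\<in>C. c \<noteq> c' \<longrightarrow> fst c \<inter> snd c' \<noteq> {} \<or> snd c \<inter> fst c' \<noteq> {})"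

definition zero_one_unique :: "'p pconcept set \<Rightarrow> bool" where
  "zero_one_unique H \<longleftrightarrow> (\<forall>h\<in>H. \<forall>h'\<in>H. \<forall>p q. h p = Some False \<longrightarrow> h q = Some True \<longrightarrow>
     h' p = Some False \<longrightarrow> h' q = Some True \<longrightarrow> h = h')"

definition points :: "'i set \<Rightarrow> nat \<Rightarrow> 'i point set" where
  "points I N = {(x, y). x \<in> I \<rightarrow>\<^sub>E {..<N} \<and> y \<subseteq> I \<times> {..<N} \<and> (\<forall>i\<in>I. (i, x i) \<notin> y)}"

text \<open>The second component of a point is the set of positions where the truth tables have the value 1.
  In a lifted term the two values exclude each other as soon as the term has a positive literal.\<close>

definition lifted_term :: "'i set \<Rightarrow> nat \<Rightarrow> 'i dnf_term \<Rightarrow> ('i \<Rightarrow> nat) \<Rightarrow> 'i point pconcept" where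
  "lifted_term I N c a = (\<lambda>(x, y).
     if (x, y) \<notin> points I N then None
     else if \<forall>i\<in>cells c. x i = a i then Some False
     else if (\<forall>i\<in>fst c. (i, a i) \<in> y) \<and> (\<forall>i\<in>snd c. (i, a i) \<notin> y) then Some True
     else None)"

definition lifted_class :: "'i set \<Rightarrow> nat \<Rightarrow> 'i dnf_term set \<Rightarrow> 'i point pconcept set" where
  "lifted_class I N C = (\<lambda>(c, a). lifted_term I N c a) ` (SIGMA c:C. cells c \<rightarrow>\<^sub>E {..<N})"

text \<open>The value 0 at \<open>(x, y)\<close> forces both guesses to equal \<open>x\<close> on
  their cells. The value 1 at \<open>(x', y')\<close> then says that both terms accept the bits of
  \<open>y'\<close> read along \<open>x\<close>, so unambiguity identifies the terms, and with them
  the guesses.\<close>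

lemma zero_one_unique_lifted:
  assumes "unambiguous C"
  shows "zero_one_unique (lifted_class I N C)"
  unfolding zero_one_unique_def
proof (intro ballI allI impI)
  fix h h' :: "'a point pconcept" and p q
  assume h: "h \<in> lifted_class I N C" "h' \<in> lifted_class I N C"
    and val: "h p = Some False" "h q = Some True" "h' p = Some False" "h' q = Some True"
  obtain x y x' y' where pq: "p = (x, y)" "q = (x', y')" by (cases p, cases q) auto
  obtain c a where c: "h = lifted_term I N c a" "c \<in> C" "a \<in> cells c \<rightarrow>\<^sub>E {..<N}"
    using h(1) by (auto simp: lifted_class_def)
  obtain c' a' where c': "h' = lifted_term I N c' a'" "c' \<in> C" "a' \<in> cells c' \<rightarrow>\<^sub>E {..<N}"
    using h(2) by (auto simp: lifted_class_def)
  have a: "x i = a i" if "i \<in> cells c" for i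
    using val(1) that by (auto simp: c pq lifted_term_def split: if_splits)
  have a': "x i = a' i" if "i \<in> cells c'" for i
    using val(3) that by (auto simp: c' pq lifted_term_def split: if_splits)
  have y: "(\<forall>i\<in>fst c. (i, a i) \<in> y') \<and> (\<forall>i\<in>snd c. (i, a i) \<notin> y')"
    using val(2) by (auto simp: c pq lifted_term_def split: if_splits)
  have y': "(\<forall>i\<in>fst c'. (i, a' i) \<in> y') \<and> (\<forall>i\<in>snd c'. (i, a' i) \<notin> y')"
    using val(4) by (auto simp: c' pq lifted_term_def split: if_splits)
  have "c = c'"
  proof (rule ccontr)
    assume "c \<noteq> c'"
    then have "fst c \<inter> snd c' \<noteq> {} \<or> snd c \<inter> fst c' \<noteq> {}"
      using assms c(2) c'(2) unfolding unambiguous_def by blast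
    then obtain i where i: "i \<in> fst c \<and> i \<in> snd c' \<or> i \<in> snd c \<and> i \<in> fst c'" by blast
    then have "a i = a' i" using a[of i] a'[of i] by (auto simp: cells_def)
    then show False using i y y' by metis
  qed
  moreover have "a = a'"
  proof
    fix i show "a i = a' i"
    proof (cases "i \<in> cells c")
      case True
      then show ?thesis using a[of i] a'[of i] \<open>c = c'\<close> by simp
    next
      case False
      then show ?thesis using c(3) c'(3) \<open>c = c'\<close> by (metis PiE_arb)
    qed
  qed
  ultimately show "h = h'" using c c' by simp
qed

section \<open>Sizes of the lifted class and the lower bound on the number of colours\<close>

lemma lifted_class_card:
  assumes C: "finite C" and wd: "\<forall>c\<in>C. finite (cells c) \<and> card (cells c) \<le> w" and N: "0 < N"
  shows "finite (lifted_class I N C)" "card (lifted_class I N C) \<le> card C * N ^ w"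
proof -
  let ?S = "SIGMA c:C. cells c \<rightarrow>\<^sub>E {..<N}"
  have finP: "finite (cells c \<rightarrow>\<^sub>E {..<N})" if "c \<in> C" for c
    using wd that by (simp add: finite_PiE)
  then have fin: "finite ?S" using C by (intro finite_SigmaI)
  then show "finite (lifted_class I N C)" by (simp add: lifted_class_def)
  have "card (lifted_class I N C) \<le> card ?S" unfolding lifted_class_def by (rule card_image_le[OF fin])
  also have "\<dots> = (\<Sum>c\<in>C. card (cells c \<rightarrow>\<^sub>E {..<N}))"
    using C finP by (intro card_SigmaI) simp_all
  also have "\<dots> \<le> (\<Sum>c\<in>C. N ^ w)"
  proof (rule sum_mono)
    fix c assume "c \<in> C"
    then show "card (cells c \<rightarrow>\<^sub>E {..<N}) \<le> N ^ w"
      using wd N by (simp add: card_PiE power_increasing)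
  qed
  finally show "card (lifted_class I N C) \<le> card C * N ^ w" by simp
qed

lemma points_card:
  assumes "finite I"
  shows "finite (points I N)" "card (points I N) \<le> N ^ card I * 2 ^ (card I * N)"
proof -
  let ?S = "(I \<rightarrow>\<^sub>E {..<N}) \<times> Pow (I \<times> {..<N})"
  have sub: "points I N \<subseteq> ?S" by (auto simp: points_def)
  have fin: "finite ?S" using assms by (intro finite_cartesian_product finite_PiE) auto
  show "finite (points I N)" by (rule finite_subset[OF sub fin])
  have "card (points I N) \<le> card ?S" by (rule card_mono[OF fin sub])
  then show "card (points I N) \<le> N ^ card I * 2 ^ (card I * N)"
    using assms by (simp add: card_cartesian_product card_PiE card_Pow)
qed

text \<open>Choose \<open>T\<close> and \<open>a\<close> maximising the size of the restricted set
  times \<open>r ^ card T\<close>; fixing further coordinates cannot increase this product, which is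
  spreadness outside \<open>T\<close>. Comparison with the empty restriction bounds
  \<open>card T\<close>: since the alphabet has size \<open>r\<^sup>2\<close>, each fixed coordinate
  costs a factor \<open>r\<close> of density.\<close>

lemma exists_spread_restriction:
  assumes I: "finite I" and A: "A \<subseteq> I \<rightarrow>\<^sub>E {..<r\<^sup>2}" "A \<noteq> {}" and r: "0 < r"
  obtains T a where "T \<subseteq> I" "a \<in> A" "spread r (I - T) {x \<in> A. \<forall>i\<in>T. x i = a i}"
    "card A * r ^ card T \<le> (r\<^sup>2) ^ card I"
proof -
  define S where "S T a = {x \<in> A. \<forall>i\<in>T. x i = a i}" for T a
  define \<Phi> where "\<Phi> = (\<lambda>(T, a). card (S T a) * r ^ card T)"
  have finA: "finite A" using A(1) I by (meson finite_PiE finite_lessThan finite_subset)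
  then have finS: "finite (S T a)" for T a by (simp add: S_def)
  have M: "finite (\<Phi> ` (Pow I \<times> A))" "\<Phi> ` (Pow I \<times> A) \<noteq> {}"
    using I finA A(2) by auto
  from Max_in[OF M] obtain m where m: "Max (\<Phi> ` (Pow I \<times> A)) = \<Phi> m" "m \<in> Pow I \<times> A"
    by (rule imageE)
  obtain T a where Ta: "m = (T, a)" "T \<subseteq> I" "a \<in> A" using m(2) by auto
  have max: "card (S T' a') * r ^ card T' \<le> card (S T a) * r ^ card T" if "T' \<subseteq> I" "a' \<in> A" for T' a'
  proof -
    have "\<Phi> (T', a') \<le> \<Phi> m" unfolding m(1)[symmetric] by (rule Max_ge[OF M(1)]) (use that in blast)
    then show ?thesis by (simp add: \<Phi>_def Ta)
  qed
  have finT: "finite T" using Ta I finite_subset by blast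
  have spr: "spread r (I - T) (S T a)"
    unfolding spread_def
  proof (intro conjI allI impI)
    show "finite (S T a)" by (rule finS)
    show "S T a \<noteq> {}" using Ta by (auto simp: S_def)
    fix J b assume J: "J \<subseteq> I - T"
    let ?B = "{x \<in> S T a. \<forall>i\<in>J. x i = b i}"
    show "r ^ card J * card ?B \<le> card (S T a)"
    proof (cases "?B = {}")
      case False
      then obtain b' where b': "b' \<in> A" "\<forall>i\<in>T. b' i = a i" "\<forall>i\<in>J. b' i = b i"
        by (auto simp: S_def)
      have "S (T \<union> J) b' = ?B" using b' by (auto simp: S_def)
      moreover have "card (T \<union> J) = card T + card J"
        using J finT I by (intro card_Un_disjoint) (auto intro: finite_subset)
      ultimately have "card ?B * r ^ card J * r ^ card T \<le> card (S T a) * r ^ card T"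
        using max[OF Un_least[OF Ta(2) order.trans[OF J Diff_subset]] b'(1)]
        by (simp add: power_add mult_ac)
      then show ?thesis using r by (simp add: mult.commute)
    next
      case True
      then show ?thesis by (simp only: card.empty mult_0_right zero_le)
    qed
  qed
  have "card A \<le> card (S T a) * r ^ card T"
    using max[of "{}" a] Ta by (simp add: S_def)
  then have "card A * r ^ card T \<le> card (S T a) * (r\<^sup>2) ^ card T"
    by (simp add: power2_eq_square power_mult_distrib)
  also have "card (S T a) \<le> (r\<^sup>2) ^ card (I - T)"
  proof -
    have "(\<lambda>x. restrict x (I - T)) ` S T a \<subseteq> (I - T) \<rightarrow>\<^sub>E {..<r\<^sup>2}"
    proof (intro image_subsetI restrict_PiE_iff[THEN iffD2] ballI)
      fix x i assume "x \<in> S T a" "i \<in> I - T"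
      then have "x \<in> I \<rightarrow>\<^sub>E {..<r\<^sup>2}" "i \<in> I" using A(1) by (auto simp only: S_def)
      then show "x i \<in> {..<r\<^sup>2}" by (rule PiE_mem)
    qed
    moreover have "inj_on (\<lambda>x. restrict x (I - T)) (S T a)"
    proof (rule inj_onI)
      fix x x' assume x: "x \<in> S T a" "x' \<in> S T a" "restrict x (I - T) = restrict x' (I - T)"
      show "x = x'"
      proof
        fix i
        consider "i \<in> T" | "i \<in> I - T" | "i \<notin> I" by blast
        then show "x i = x' i"
        proof cases
          case 1 then show ?thesis using x by (simp add: S_def)
        next
          case 2 then show ?thesis using fun_cong[OF x(3), of i] by simp
        next
          case 3
          have "x \<in> I \<rightarrow>\<^sub>E {..<r\<^sup>2}" "x' \<in> I \<rightarrow>\<^sub>E {..<r\<^sup>2}" using x(1,2) A(1) by (auto simp only: S_def)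
          then show ?thesis using 3 by (metis PiE_arb)
        qed
      qed
    qed
    ultimately have "card (S T a) \<le> card ((I - T) \<rightarrow>\<^sub>E {..<r\<^sup>2})"
      using I by (intro card_inj_on_le finite_PiE) simp_all
    then show ?thesis using I by (simp add: card_PiE)
  qed
  finally have "card A * r ^ card T \<le> (r\<^sup>2) ^ card (I - T) * (r\<^sup>2) ^ card T" by simp
  also have "\<dots> = (r\<^sup>2) ^ card I"
    using I Ta finT by (simp add: card_Diff_subset card_mono flip: power_add)
  finally show ?thesis using that[OF Ta(2,3)] spr by (simp add: S_def)
qed

lemma spread_mono: "spread r D X \<Longrightarrow> D' \<subseteq> D \<Longrightarrow> spread r D' X"
  by (auto simp: spread_def)

lemma exists_large_fibre:
  assumes "finite A" "f ` A \<subseteq> B" "finite B" "B \<noteq> {}"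
  obtains b where "b \<in> B" "card A \<le> card {a \<in> A. f a = b} * card B"
proof -
  have "f \<in> A \<rightarrow> B" using assms(2) by blast
  from pigeonhole_card[OF this assms(1,3,4)] obtain b where "b \<in> B" "card A \<le> card (f -` {b} \<inter> A) * card B"
    by blast
  moreover have "f -` {b} \<inter> A = {a \<in> A. f a = b}" by blast
  ultimately show ?thesis using that by simp
qed

lemma card_points_over:
  assumes I: "finite I" and x: "x \<in> I \<rightarrow>\<^sub>E {..<N}"
  shows "card {y. (x, y) \<in> points I N} * 2 ^ card I = 2 ^ (card I * N)"
proof -
  let ?g = "(\<lambda>i. (i, x i)) ` I"
  have "{y. (x, y) \<in> points I N} = Pow (I \<times> {..<N} - ?g)"
    using x by (auto simp: points_def)
  moreover have g: "?g \<subseteq> I \<times> {..<N}" "card ?g = card I" using x by (auto simp: card_image inj_on_def)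
  moreover have "card I \<le> card I * N"
    using card_mono[OF _ g(1)] g(2) I by (simp add: card_cartesian_product)
  ultimately show ?thesis
    using I by (simp add: card_Pow card_Diff_subset card_cartesian_product flip: power_add)
qed

text \<open>With fewer than \<open>r ^ t\<close> colours, one colour \<open>b\<close> is the most
  popular one over a dense set \<open>A\<close> of \<open>x\<close>. Restricting \<open>A\<close>
  makes it spread off a set \<open>T\<close> of fewer than \<open>t\<close> cells, and
  \<open>cert\<close> supplies a term without positive literals in \<open>T\<close>. By
  \<open>card_no_fit\<close> some table \<open>y\<close> with \<open>(x0, y)\<close> of colour
  \<open>b\<close> satisfies that term along some \<open>x\<close> in the restricted set. The term
  with guess \<open>x\<close> is then 1 at \<open>(x0, y)\<close> and 0 at a point of colour
  \<open>b\<close> over \<open>x\<close>.\<close>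

lemma many_colours:
  fixes col :: "'i point \<Rightarrow> 'k" and k r t w :: nat
  assumes I: "finite I"
    and C: "\<And>c. c \<in> C \<Longrightarrow> cells c \<subseteq> I \<and> card (cells c) \<le> w \<and> fst c \<noteq> {} \<and> fst c \<inter> snd c = {}"
    and cert: "\<And>T. T \<subseteq> I \<Longrightarrow> card T < t \<Longrightarrow> \<exists>c\<in>C. fst c \<inter> T = {}"
    and r: "8 * k * w \<le> r" "1 < r" and k: "0 < k" "2 ^ card I * r ^ t \<le> (2::nat) ^ k"
    and col: "\<And>h p q. h \<in> lifted_class I (r\<^sup>2) C \<Longrightarrow> p \<in> points I (r\<^sup>2) \<Longrightarrow> q \<in> points I (r\<^sup>2) \<Longrightarrow>
       col p = col q \<Longrightarrow> h p = Some False \<Longrightarrow> h q \<noteq> Some True"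
  shows "r ^ t \<le> card (col ` points I (r\<^sup>2))"
proof (rule ccontr)
  define N where "N = r\<^sup>2"
  define P where "P = points I N"
  define Q where "Q = card (col ` P)"
  define Y where "Y x = {y. (x, y) \<in> P}" for x
  assume "\<not> ?thesis"
  then have Q: "Q < r ^ t" by (simp add: Q_def P_def N_def)
  have N0: "0 < N" using r by (simp add: N_def)
  have finP: "finite P" using points_card[OF I] by (simp add: P_def)
  have finY: "finite (Y x)" for x
    by (rule finite_subset[of _ "snd ` P"]) (use finP in \<open>force simp: Y_def\<close>)+
  have cardY: "card (Y x) * 2 ^ card I = 2 ^ (card I * N)" if "x \<in> I \<rightarrow>\<^sub>E {..<N}" for x
    using card_points_over[OF I that] by (simp add: Y_def P_def)
  let ?X = "I \<rightarrow>\<^sub>E {..<N}"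
  have "0 < card ?X" using I N0 by (simp add: card_PiE)
  then have X: "finite ?X" "?X \<noteq> {}" by (simp_all add: card_gt_0_iff)
  have Y0: "Y x \<noteq> {}" if "x \<in> ?X" for x
  proof
    assume "Y x = {}"
    then show False using cardY[OF that] by simp
  qed
  have colP: "finite (col ` P)" "col ` P \<noteq> {}"
  proof -
    obtain x where "x \<in> ?X" using X(2) by blast
    then show "col ` P \<noteq> {}" using Y0[of x] by (auto simp: Y_def)
  qed (use finP in simp)
  have "\<exists>b\<in>col ` P. card (Y x) \<le> card {y \<in> Y x. col (x, y) = b} * Q" for x
    unfolding Q_def
    by (rule exists_large_fibre[of "Y x" "\<lambda>y. col (x, y)" "col ` P"])
       (use finY colP in \<open>auto simp: Y_def\<close>)
  then have "\<forall>x. \<exists>b. b \<in> col ` P \<and> card (Y x) \<le> card {y \<in> Y x. col (x, y) = b} * Q" by blast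
  from choice[OF this] obtain f where f: "\<And>x. f x \<in> col ` P"
      "\<And>x. card (Y x) \<le> card {y \<in> Y x. col (x, y) = f x} * Q"
    by blast
  obtain b where b: "card ?X \<le> card {x \<in> ?X. f x = b} * Q"
    unfolding Q_def
    by (rule exists_large_fibre[of ?X f "col ` P"]) (use X f(1) colP in auto)
  define A where "A = {x \<in> ?X. f x = b}"
  have bigA: "N ^ card I \<le> card A * Q" using b I by (simp add: A_def card_PiE)
  then have A0: "A \<noteq> {}" using N0 by auto
  have A1: "A \<subseteq> I \<rightarrow>\<^sub>E {..<r\<^sup>2}" by (auto simp: A_def N_def)
  have "0 < r" using r by simp
  from exists_spread_restriction[OF I A1 A0 this] obtain T x0 where T: "T \<subseteq> I" "x0 \<in> A"
      "spread r (I - T) {x \<in> A. \<forall>i\<in>T. x i = x0 i}" "card A * r ^ card T \<le> N ^ card I"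
    unfolding N_def by blast
  define X0 where "X0 = {x \<in> A. \<forall>i\<in>T. x i = x0 i}"
  have "card T < t"
  proof -
    have "card A * r ^ card T \<le> card A * Q" using T(4) bigA by linarith
    moreover have "0 < card A" using A0 finite_subset[OF _ X(1), of A] by (auto simp: A_def card_gt_0_iff)
    ultimately have "r ^ card T \<le> Q" by simp
    then have "r ^ card T < r ^ t" using Q by linarith
    then show ?thesis using r(2) by simp
  qed
  then obtain c where c: "c \<in> C" "fst c \<inter> T = {}" using cert[OF T(1)] by blast
  have cI: "cells c \<subseteq> I" "card (cells c) \<le> w" "fst c \<noteq> {}" "fst c \<inter> snd c = {}"
    using C[OF c(1)] by auto
  define D where "D = cells c - T"
  have D: "finite D" "card D \<le> w" "D \<subseteq> I - T"
    using cI I finite_subset[OF cI(1) I] card_mono[of "cells c" D] by (auto simp: D_def)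
  let ?U = "I \<times> {..<N}"
  define bad where "bad = {y \<in> Pow ?U. \<forall>x\<in>X0. \<not> (\<forall>i\<in>D. (i, x i) \<in> y \<longleftrightarrow> i \<in> fst c)}"
  \<comment> \<open>Using \<open>2 * k\<close> random colours makes the failure probability at most
    \<open>exp (- k)\<close>, hence at most \<open>1 / 2 ^ k\<close>.\<close>
  have "card bad * exp (real (2 * k) / 2) \<le> 2 ^ card ?U"
    unfolding bad_def
  proof (rule card_no_fit)
    show "spread r D X0" using spread_mono[OF T(3) D(3)] by (simp add: X0_def)
    show "finite D" "card D \<le> w" by (rule D)+
    show "4 * (2 * k) * w \<le> r" "0 < r" "0 < 2 * k" using r k by simp_all
    show "finite ?U" using I by simp
    show "\<And>x i. x \<in> X0 \<Longrightarrow> i \<in> D \<Longrightarrow> (i, x i) \<in> ?U"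
      using D(3) by (auto simp: X0_def A_def)
  qed
  define B where "B = {y \<in> Y x0. col (x0, y) = b}"
  have x0: "x0 \<in> ?X" "f x0 = b" using T(2) by (auto simp: A_def)
  \<comment> \<open>The points over \<open>x0\<close> make up a fraction
    \<open>1 / 2 ^ card I\<close> of all tables, and colour \<open>b\<close> takes more than
    \<open>1 / r ^ t\<close> of them. So \<open>B\<close> has density above
    \<open>1 / 2 ^ k\<close>, more than \<open>bad\<close> can have.\<close>
  have "card bad < card B"
  proof -
    have "2 ^ (card I * N) = card (Y x0) * 2 ^ card I" using cardY[OF x0(1)] by simp
    also have "\<dots> \<le> card B * Q * 2 ^ card I"
      using f(2)[of x0] x0(2) by (simp add: B_def)
    finally have le: "2 ^ (card I * N) \<le> card B * (Q * 2 ^ card I)" by (simp add: mult_ac)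
    then have B0: "0 < card B" by (cases "card B = 0") auto
    have "Q * 2 ^ card I < 2 ^ card I * r ^ t" using Q by simp
    then have "Q * 2 ^ card I < 2 ^ k" using k(2) by linarith
    then have "card B * (Q * 2 ^ card I) < card B * 2 ^ k" using B0 by simp
    with le have "2 ^ (card I * N) < card B * 2 ^ k" by linarith
    then have lt: "(2::real) ^ (card I * N) < real (card B) * 2 ^ k"
      unfolding of_nat_less_iff[where 'a = real, symmetric]
      by (simp only: of_nat_power of_nat_mult of_nat_numeral)
    have "(2::real) ^ k \<le> exp 1 ^ k" using exp_ge_add_one_self[of 1] by (intro power_mono) auto
    also have "\<dots> = exp (real (2 * k) / 2)" by (simp add: exp_of_nat_mult[symmetric])
    finally have "real (card bad) * 2 ^ k \<le> card bad * exp (real (2 * k) / 2)" by (intro mult_left_mono) auto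
    also have "\<dots> \<le> 2 ^ (card I * N)"
      using \<open>card bad * exp (real (2 * k) / 2) \<le> 2 ^ card ?U\<close> by (simp add: card_cartesian_product)
    finally have "real (card bad) * 2 ^ k < real (card B) * 2 ^ k" using lt by (rule le_less_trans)
    then show ?thesis by simp
  qed
  moreover have "finite bad" using I by (simp add: bad_def)
  ultimately have "\<not> B \<subseteq> bad" using card_mono leD by metis
  then obtain y where y: "y \<in> B" "y \<notin> bad" by blast
  have yP: "(x0, y) \<in> P" "col (x0, y) = b" using y(1) by (auto simp: B_def Y_def)
  then have "y \<in> Pow ?U" by (simp add: P_def points_def)
  then obtain x where x: "x \<in> X0" "\<And>i. i \<in> D \<Longrightarrow> (i, x i) \<in> y \<longleftrightarrow> i \<in> fst c"
    using y(2) unfolding bad_def by blast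
  have xA: "x \<in> ?X" "f x = b" "\<And>i. i \<in> T \<Longrightarrow> x i = x0 i" using x(1) by (auto simp: X0_def A_def)
  have "{y \<in> Y x. col (x, y) = b} \<noteq> {}"
  proof
    assume "{y \<in> Y x. col (x, y) = b} = {}"
    then have "card {y \<in> Y x. col (x, y) = f x} = 0" unfolding xA(2) by (simp only: card.empty)
    then have "card (Y x) = 0" using f(2)[of x] by simp
    then show False using Y0[OF xA(1)] finY by simp
  qed
  then obtain y1 where y1: "(x, y1) \<in> P" "col (x, y1) = b" by (auto simp: Y_def)
  define a where "a = restrict x (cells c)"
  have a: "a i = x i" if "i \<in> cells c" for i using that by (simp add: a_def)
  have "a \<in> cells c \<rightarrow>\<^sub>E {..<N}" using xA(1) cI(1) by (auto simp: a_def)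
  then have h: "lifted_term I N c a \<in> lifted_class I N C"
    using c(1) unfolding lifted_class_def by (intro image_eqI[of _ _ "(c, a)"]) auto
  have pos: "(i, a i) \<in> y" if "i \<in> fst c" for i
  proof -
    have "i \<in> cells c" "i \<in> D" using that c(2) by (auto simp: D_def cells_def)
    then show ?thesis using x(2) a that by simp
  qed
  \<comment> \<open>Negative literals may lie in \<open>T\<close>. There \<open>x\<close> agrees
    with \<open>x0\<close>, and \<open>(x0, y)\<close> being a point makes the bit 0, as
    required.\<close>
  have neg: "(i, a i) \<notin> y" if "i \<in> snd c" for i
  proof (cases "i \<in> T")
    case True
    then have "a i = x0 i" using xA(3) a that by (simp add: cells_def)
    moreover have "i \<in> I" using True T by blast
    ultimately show ?thesis using yP(1) by (simp add: P_def points_def)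
  next
    case False
    moreover have "i \<notin> fst c" using cI(4) that by blast
    ultimately show ?thesis using that x(2)[of i] a[of i] by (simp add: D_def cells_def)
  qed
  have "lifted_term I N c a (x, y1) = Some False"
    using y1(1) a by (simp add: lifted_term_def P_def)
  \<comment> \<open>In \<open>lifted_term\<close> the value 0 takes precedence. A positive literal
    excludes it: its bit is 1 at \<open>a i\<close> but 0 at \<open>x0 i\<close>, so the guess is
    wrong at \<open>x0\<close>.\<close>
  moreover have "lifted_term I N c a (x0, y) = Some True"
  proof -
    obtain i where i: "i \<in> fst c" using cI(3) by blast
    then have "i \<in> cells c" "i \<in> I" using cI(1) by (auto simp: cells_def)
    then have "(i, x0 i) \<notin> y" using yP(1) by (simp add: P_def points_def)
    then have "x0 i \<noteq> a i" using pos[OF i] by metis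
    then show ?thesis
      using yP(1) pos neg \<open>i \<in> cells c\<close> by (auto simp: lifted_term_def P_def)
  qed
  ultimately show False
    using col[of "lifted_term I N c a" "(x, y1)" "(x0, y)"] h y1 yP by (simp add: P_def N_def)
qed

section \<open>An unambiguous DNF whose zero input is hard to refute\<close>

text \<open>Blocks \<open>i < s\<^sup>6\<close>. For every datum \<open>e < s\<^sup>3\<close> the cells \<open>Ptr i e j u\<close> hold a pointer, a one-hot encoding of a
  name \<open>(P, v)\<close> with \<open>P\<close> a set of data and \<open>v\<close> a triple of data; \<open>Ptr i e 0 e = 1\<close> says that
  the pointer is switched on.\<close>

datatype cell = Ptr nat nat nat nat | Wit nat nat nat nat

type_synonym name = "nat set \<times> nat \<times> nat \<times> nat"

text \<open>Row 0 is the indicator of \<open>P\<close>, rows 1 to 3 are one-hot. For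
  \<open>e\<close> in \<open>P\<close> the bit in row 0 at \<open>e\<close> is 1, so
  \<open>Ptr i e 0 e\<close> can serve as the switch.\<close>

fun name_bit :: "name \<Rightarrow> nat \<Rightarrow> nat \<Rightarrow> bool" where
  "name_bit (P, v1, v2, v3) j u =
     (j = 0 \<and> u \<in> P \<or> j = 1 \<and> u = v1 \<or> j = 2 \<and> u = v2 \<or> j = 3 \<and> u = v3)"

text \<open>Literals on pointers of the own block separate terms of the same block; witnesses and
  switches separate different blocks. Positive literals sit only on pointers of \<open>P\<close> in
  block \<open>i\<close> and on the witnesses of a single triple, which lets them dodge a small set
  of cells.\<close>

fun block_term :: "nat \<Rightarrow> nat \<times> name \<Rightarrow> cell dnf_term" where
  "block_term s (i, P, v1, v2, v3) =
     ({Ptr i e j u | e j u. e \<in> P \<and> j < 4 \<and> u < s ^ 3 \<and> name_bit (P, v1, v2, v3) j u}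
        \<union> {Wit i' v1 v2 v3 | i'. i' < s ^ 6 \<and> i' \<noteq> i},
      {Ptr i e j u | e j u. e \<in> P \<and> j < 4 \<and> u < s ^ 3 \<and> \<not> name_bit (P, v1, v2, v3) j u}
        \<union> {Wit i u1 u2 u3 | u1 u2 u3. u1 \<in> {..<s ^ 3} - P \<and> u2 \<in> {..<s ^ 3} - P \<and> u3 \<in> {..<s ^ 3} - P}
        \<union> {Ptr i' e 0 e | i' e. i' < s ^ 6 \<and> i' \<noteq> i \<and> e \<in> {v1, v2, v3}})"

text \<open>The bound \<open>s ^ 2\<close> on the complement keeps the number of own witnesses in a
  term at \<open>(s ^ 2) ^ 3 = s ^ 6\<close>. It also matches the adversary: with fewer than
  \<open>s ^ 8\<close> cells not all of the \<open>s ^ 6\<close> blocks can have more than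
  \<open>s ^ 2\<close> data touched.\<close>

definition block_names :: "nat \<Rightarrow> (nat \<times> name) set" where
  "block_names s = {..<s ^ 6} \<times> {P. P \<subseteq> {..<s ^ 3} \<and> card ({..<s ^ 3} - P) \<le> s ^ 2}
     \<times> {..<s ^ 3} \<times> {..<s ^ 3} \<times> {..<s ^ 3}"

definition block_dnf :: "nat \<Rightarrow> cell dnf_term set" where
  "block_dnf s = block_term s ` block_names s"

definition block_cells :: "nat \<Rightarrow> cell set" where
  "block_cells s = (\<lambda>(i, e, j, u). Ptr i e j u) ` ({..<s ^ 6} \<times> {..<s ^ 3} \<times> {..<4} \<times> {..<s ^ 3})
     \<union> (\<lambda>(i, u1, u2, u3). Wit i u1 u2 u3) ` ({..<s ^ 6} \<times> {..<s ^ 3} \<times> {..<s ^ 3} \<times> {..<s ^ 3})"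

lemma block_cells: "finite (block_cells s)" "card (block_cells s) \<le> 4 * s ^ 12 + s ^ 15"
proof -
  let ?A = "{..<s ^ 6} \<times> {..<s ^ 3} \<times> {..<4::nat} \<times> {..<s ^ 3}"
  let ?B = "{..<s ^ 6} \<times> {..<s ^ 3} \<times> {..<s ^ 3} \<times> {..<s ^ 3}"
  show "finite (block_cells s)" by (simp add: block_cells_def)
  have "card (block_cells s) \<le> card ?A + card ?B"
    unfolding block_cells_def
    by (rule order.trans[OF card_Un_le]) (intro add_mono card_image_le, simp_all)
  also have "\<dots> = 4 * s ^ 12 + s ^ 15" by (simp add: card_cartesian_product flip: power_add)
  finally show "card (block_cells s) \<le> 4 * s ^ 12 + s ^ 15" .
qed

lemma block_dnf_card: "finite (block_dnf s)" "card (block_dnf s) \<le> s ^ 15 * 2 ^ s ^ 3"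
proof -
  let ?S = "{..<s ^ 6} \<times> Pow {..<s ^ 3} \<times> {..<s ^ 3} \<times> {..<s ^ 3} \<times> {..<s ^ 3}"
  have sub: "block_names s \<subseteq> ?S" by (auto simp: block_names_def)
  have fin: "finite ?S" by simp
  have finB: "finite (block_names s)" by (rule finite_subset[OF sub fin])
  then show "finite (block_dnf s)" by (simp add: block_dnf_def)
  have "card (block_dnf s) \<le> card (block_names s)"
    unfolding block_dnf_def by (rule card_image_le[OF finB])
  also have "\<dots> \<le> card ?S" by (rule card_mono[OF fin sub])
  also have "\<dots> = s ^ 15 * 2 ^ s ^ 3"
    by (simp add: card_cartesian_product card_Pow mult_ac flip: power_add)
  finally show "card (block_dnf s) \<le> s ^ 15 * 2 ^ s ^ 3" .
qed

text \<open>Both sets miss at most \<open>s ^ 2\<close> of the \<open>s ^ 3\<close> data, and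
  \<open>2 * s ^ 2 < s ^ 3\<close>. A common datum is where two names of one block get compared; the
  case of equal sets gives a positive literal in every term.\<close>

lemma block_names_meet:
  assumes s: "2 < s" and P: "P \<subseteq> {..<s ^ 3}" "card ({..<s ^ 3} - P) \<le> s ^ 2"
    and P': "card ({..<s ^ 3} - P') \<le> s ^ 2"
  shows "P \<inter> P' \<noteq> {}"
proof
  assume "P \<inter> P' = {}"
  then have "{..<s ^ 3} = ({..<s ^ 3} - P) \<union> ({..<s ^ 3} - P')" by blast
  then have "s ^ 3 \<le> card ({..<s ^ 3} - P) + card ({..<s ^ 3} - P')"
    by (metis card_Un_le card_lessThan)
  also have "\<dots> \<le> 2 * s ^ 2" using P P' by simp
  also have "\<dots> < s * s ^ 2" using s by simp
  finally show False by (simp add: power3_eq_cube power2_eq_square)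
qed

lemma name_bit_inj:
  assumes "n \<noteq> n'" "n \<in> Pow {..<m} \<times> {..<m} \<times> {..<m} \<times> {..<m}"
    "n' \<in> Pow {..<m} \<times> {..<m} \<times> {..<m} \<times> {..<m}"
  obtains j u where "j < 4" "u < m" "name_bit n j u \<noteq> name_bit n' j u"
proof -
  obtain P v1 v2 v3 where n: "n = (P, v1, v2, v3)" by (cases n) auto
  obtain P' v1' v2' v3' where n': "n' = (P', v1', v2', v3')" by (cases n') auto
  consider "v1 \<noteq> v1'" | "v2 \<noteq> v2'" | "v3 \<noteq> v3'" | u where "u \<in> P \<longleftrightarrow> u \<notin> P'"
    using assms(1) unfolding n n' by blast
  then show ?thesis
  proof cases
    case 1 then show ?thesis using that[of 1 v1] assms(2) by (simp add: n n')
  next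
    case 2 then show ?thesis using that[of 2 v2] assms(2) by (simp add: n n')
  next
    case 3 then show ?thesis using that[of 3 v3] assms(2) by (simp add: n n')
  next
    case 4
    then have "u < m" using assms(2,3) by (auto simp: n n')
    then show ?thesis using that[of 0 u] 4 by (simp add: n n')
  qed
qed

text \<open>Two names of different blocks \<open>i \<noteq> i'\<close>: in block \<open>i\<close> the second term switches off the data of its triple and
  switches on the witness of that triple. The first term either switches on one of these data or switches
  off that witness.\<close>

lemma block_dnf_unambiguous:
  assumes s: "2 < s"
  shows "unambiguous (block_dnf s)"
proof -
  have conflict: "fst (block_term s b) \<inter> snd (block_term s b') \<noteq> {}
      \<or> snd (block_term s b) \<inter> fst (block_term s b') \<noteq> {}"
    if b: "b \<in> block_names s" "b' \<in> block_names s" "b \<noteq> b'" for b b'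
  proof -
    obtain i P v1 v2 v3 where b1: "b = (i, P, v1, v2, v3)" by (cases b) auto
    obtain i' P' v1' v2' v3' where b2: "b' = (i', P', v1', v2', v3')" by (cases b') auto
    have P: "P \<subseteq> {..<s ^ 3}" "card ({..<s ^ 3} - P) \<le> s ^ 2" "P' \<subseteq> {..<s ^ 3}"
        "card ({..<s ^ 3} - P') \<le> s ^ 2"
      and v: "v1 < s ^ 3" "v2 < s ^ 3" "v3 < s ^ 3" "v1' < s ^ 3" "v2' < s ^ 3" "v3' < s ^ 3"
      and i: "i < s ^ 6" "i' < s ^ 6"
      using b(1,2) by (simp_all add: b1 b2 block_names_def)
    show ?thesis
    proof (cases "i = i'")
      case True
      then have "(P, v1, v2, v3) \<noteq> (P', v1', v2', v3')" using b(3) by (simp add: b1 b2)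
      then obtain j u where ju: "j < 4" "u < s ^ 3"
          "name_bit (P, v1, v2, v3) j u \<noteq> name_bit (P', v1', v2', v3') j u"
        by (rule name_bit_inj[of _ _ "s ^ 3"]) (use P v in auto)
      \<comment> \<open>Within one block the pointer of a common datum would have to hold two
        different names.\<close>
      obtain e where e: "e \<in> P" "e \<in> P'" using block_names_meet[OF s P(1,2,4)] by blast
      have on: "Ptr i e j u \<in> fst (block_term s (i, N)) \<longleftrightarrow> name_bit N j u"
        and off: "Ptr i e j u \<in> snd (block_term s (i, N)) \<longleftrightarrow> \<not> name_bit N j u"
        if "N = (P, v1, v2, v3) \<or> N = (P', v1', v2', v3')" for N
        using that e ju(1,2) by (auto simp del: name_bit.simps)
      show ?thesis
        using on[of "(P, v1, v2, v3)"] on[of "(P', v1', v2', v3')"] off[of "(P, v1, v2, v3)"]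
          off[of "(P', v1', v2', v3')"] ju(3) True unfolding b1 b2 by blast
    next
      case False
      show ?thesis
      proof (cases "v1' \<in> P \<or> v2' \<in> P \<or> v3' \<in> P")
        case True
        then obtain e where e: "e \<in> P" "e \<in> {v1', v2', v3'}" by blast
        then have "e < s ^ 3" using P(1) by blast
        then have "Ptr i e 0 e \<in> fst (block_term s b)" using e(1) by (auto simp: b1)
        moreover have "Ptr i e 0 e \<in> snd (block_term s b')" using e(2) i False by (auto simp: b2)
        ultimately show ?thesis by blast
      next
        case outside: False
        then have "Wit i v1' v2' v3' \<in> snd (block_term s b)" using v by (auto simp: b1)
        moreover have "Wit i v1' v2' v3' \<in> fst (block_term s b')" using i False by (auto simp: b2)
        ultimately show ?thesis by blast
      qed
    qed
  qed
  show ?thesis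
    unfolding unambiguous_def block_dnf_def
  proof (intro ballI impI)
    fix c c' assume "c \<in> block_term s ` block_names s" "c' \<in> block_term s ` block_names s" "c \<noteq> c'"
    then obtain b b' where b: "c = block_term s b" "c' = block_term s b'"
        "b \<in> block_names s" "b' \<in> block_names s" by (elim imageE)
    then have "b \<noteq> b'" using \<open>c \<noteq> c'\<close> by blast
    then show "fst c \<inter> snd c' \<noteq> {} \<or> snd c \<inter> fst c' \<noteq> {}"
      unfolding b(1,2) by (rule conflict[OF b(3,4)])
  qed
qed

text \<open>The width splits into \<open>4 * s ^ 6\<close> pointer cells of the own block,
  \<open>s ^ 6\<close> witnesses in other blocks, \<open>s ^ 6\<close> witnesses in the own block
  and \<open>3 * s ^ 6\<close> switches, counted by \<open>c1\<close> to \<open>c4\<close>.\<close>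

lemma block_term_props:
  assumes s: "2 < s" and b: "b \<in> block_names s"
  shows "cells (block_term s b) \<subseteq> block_cells s" "card (cells (block_term s b)) \<le> 9 * s ^ 6"
    "fst (block_term s b) \<noteq> {}" "fst (block_term s b) \<inter> snd (block_term s b) = {}"
proof -
  obtain i P v1 v2 v3 where b1: "b = (i, P, v1, v2, v3)" by (cases b) auto
  have P: "P \<subseteq> {..<s ^ 3}" "card ({..<s ^ 3} - P) \<le> s ^ 2"
    and v: "v1 < s ^ 3" "v2 < s ^ 3" "v3 < s ^ 3" and i: "i < s ^ 6"
    using b by (simp_all add: b1 block_names_def)
  show "cells (block_term s b) \<subseteq> block_cells s"
    using P(1) v i by (auto simp: cells_def b1 block_cells_def image_iff)
  obtain e where "e \<in> P" using block_names_meet[OF s P P(2)] by blast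
  then have "Ptr i e 0 e \<in> fst (block_term s b)" using P(1) by (auto simp: b1)
  then show "fst (block_term s b) \<noteq> {}" by blast
  show "fst (block_term s b) \<inter> snd (block_term s b) = {}" by (auto simp: b1 simp del: name_bit.simps)
  let ?Q = "{..<s ^ 3} - P"
  define c1 where "c1 = (\<lambda>(e, j, u). Ptr i e j u) ` ({..<s ^ 3} \<times> {..<4} \<times> {..<s ^ 3})"
  define c2 where "c2 = (\<lambda>i'. Wit i' v1 v2 v3) ` {..<s ^ 6}"
  define c3 where "c3 = (\<lambda>(u1, u2, u3). Wit i u1 u2 u3) ` (?Q \<times> ?Q \<times> ?Q)"
  define c4 where "c4 = (\<lambda>(i', e). Ptr i' e 0 e) ` ({..<s ^ 6} \<times> {v1, v2, v3})"
  have "card c1 \<le> card ({..<s ^ 3} \<times> {..<4::nat} \<times> {..<s ^ 3})" unfolding c1_def by (rule card_image_le) simp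
  then have 1: "card c1 \<le> 4 * s ^ 6" by (simp add: card_cartesian_product mult.left_commute flip: power_add)
  have 2: "card c2 \<le> s ^ 6" unfolding c2_def by (rule order.trans[OF card_image_le]) simp_all
  have "card c3 \<le> card (?Q \<times> ?Q \<times> ?Q)" unfolding c3_def by (rule card_image_le) simp
  also have "\<dots> \<le> s ^ 2 * (s ^ 2 * s ^ 2)" unfolding card_cartesian_product by (intro mult_mono P(2)) auto
  finally have 3: "card c3 \<le> s ^ 6" by (simp flip: power_add)
  have "card c4 \<le> card ({..<s ^ 6} \<times> {v1, v2, v3})" unfolding c4_def by (rule card_image_le) simp
  also have "\<dots> \<le> s ^ 6 * 3"
    unfolding card_cartesian_product by (intro mult_mono) (auto simp: card_insert_if)
  finally have 4: "card c4 \<le> 3 * s ^ 6" by simp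
  have "cells (block_term s b) \<subseteq> c1 \<union> c2 \<union> c3 \<union> c4"
    using P(1) by (auto simp: cells_def b1 c1_def c2_def c3_def c4_def image_iff)
  then have "card (cells (block_term s b)) \<le> card (c1 \<union> c2 \<union> c3 \<union> c4)"
    by (rule card_mono[rotated]) (simp add: c1_def c2_def c3_def c4_def)
  also have "\<dots> \<le> card c1 + card c2 + card c3 + card c4"
    by (meson add_mono card_Un_le order.trans order_refl)
  finally show "card (cells (block_term s b)) \<le> 9 * s ^ 6" using 1 2 3 4 by linarith
qed

text \<open>By averaging, \<open>T\<close> touches at most \<open>s ^ 2\<close> data of some block
  \<open>i\<close>, and since there are \<open>s ^ 9\<close> triples, the witnesses of some triple
  avoid \<open>T\<close> in all blocks. The term of block \<open>i\<close> for the untouched data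
  and this triple has no positive literal in \<open>T\<close>.\<close>

lemma block_dnf_avoids:
  assumes s: "2 < s" and T: "finite T" "card T < s ^ 8"
  shows "\<exists>c\<in>block_dnf s. fst c \<inter> T = {}"
proof -
  define E where "E i = {e. \<exists>j u. Ptr i e j u \<in> T}" for i
  define TP where "TP i = {z \<in> T. \<exists>e j u. z = Ptr i e j u}" for i
  have ET: "card (E i) \<le> card (TP i)" for i
  proof -
    have "E i \<subseteq> (\<lambda>z. case z of Ptr i e j u \<Rightarrow> e | _ \<Rightarrow> 0) ` TP i"
      by (force simp: E_def TP_def)
    then show ?thesis by (rule surj_card_le[rotated]) (use T in \<open>simp add: TP_def\<close>)
  qed
  have "\<exists>i<s ^ 6. card (E i) \<le> s ^ 2"
  proof (rule ccontr)
    assume "\<not> ?thesis"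
    then have "(\<Sum>i<s ^ 6. s ^ 2) \<le> (\<Sum>i<s ^ 6. card (E i))" by (intro sum_mono) auto
    also have "\<dots> \<le> (\<Sum>i<s ^ 6. card (TP i))" using ET by (intro sum_mono) auto
    also have "\<dots> = card (\<Union>i<s ^ 6. TP i)"
      by (rule card_UN_disjoint[symmetric]) (use T in \<open>auto simp: TP_def\<close>)
    also have "\<dots> \<le> card T" using T by (intro card_mono) (auto simp: TP_def)
    finally show False using T(2) by (simp flip: power_add)
  qed
  then obtain i where i: "i < s ^ 6" "card (E i) \<le> s ^ 2" by blast
  let ?V = "{..<s ^ 3} \<times> {..<s ^ 3} \<times> {..<s ^ 3}"
  \<comment> \<open>Pointer cells get a default triple. This may exclude one triple needlessly, but
    the image still has at most \<open>card T\<close> elements.\<close>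
  have "\<not> ?V \<subseteq> (\<lambda>z. case z of Wit i u1 u2 u3 \<Rightarrow> (u1, u2, u3) | _ \<Rightarrow> (0, 0, 0)) ` T"
  proof
    assume "?V \<subseteq> (\<lambda>z. case z of Wit i u1 u2 u3 \<Rightarrow> (u1, u2, u3) | _ \<Rightarrow> (0, 0, 0)) ` T"
    then have "card ?V \<le> card T" by (rule surj_card_le[OF T(1)])
    moreover have "card ?V = s ^ 9" by (simp add: card_cartesian_product flip: power_add)
    moreover have "s ^ 8 \<le> s ^ 9" using s by (intro power_increasing) auto
    ultimately show False using T(2) by linarith
  qed
  then obtain v1 v2 v3 where v: "v1 < s ^ 3" "v2 < s ^ 3" "v3 < s ^ 3" "\<And>i'. Wit i' v1 v2 v3 \<notin> T"
    by (force simp: image_iff)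
  define P where "P = {..<s ^ 3} - E i"
  have finE: "finite (E i)"
    by (rule finite_subset[of _ "(\<lambda>z. case z of Ptr i e j u \<Rightarrow> e | _ \<Rightarrow> 0) ` T"])
       (use T in \<open>force simp: E_def\<close>)+
  have "card ({..<s ^ 3} - P) \<le> card (E i)" by (rule card_mono[OF finE]) (auto simp: P_def)
  then have "(i, P, v1, v2, v3) \<in> block_names s" using i v by (auto simp: block_names_def P_def)
  moreover have "fst (block_term s (i, P, v1, v2, v3)) \<inter> T = {}"
    using v(4) by (auto simp: P_def E_def simp del: name_bit.simps)
  ultimately show ?thesis unfolding block_dnf_def by blast
qed

section \<open>Forced shattering\<close>

text \<open>Unlike in a disambiguation, one function must agree on the whole support at once, and
  nothing is asked of it elsewhere. This form is independent of the domain and easy to transport;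
  for finite supports a disambiguation provides it.\<close>

definition completes :: "('p \<Rightarrow> bool) set \<Rightarrow> 'p pconcept set \<Rightarrow> bool" where
  "completes F H \<longleftrightarrow> (\<forall>h\<in>H. \<exists>f\<in>F. \<forall>x b. h x = Some b \<longrightarrow> f x = b)"

definition forces_shattering :: "'p set \<Rightarrow> 'p pconcept set \<Rightarrow> nat \<Rightarrow> bool" where
  "forces_shattering P H d \<longleftrightarrow>
     (\<forall>F. completes F H \<longrightarrow> (\<exists>S\<subseteq>P. card S = d \<and> shatters (as_partial F) S))"

lemma shatters_as_partial:
  "shatters (as_partial F) S \<longleftrightarrow> finite S \<and> (\<forall>y. \<exists>f\<in>F. \<forall>x\<in>S. f x = y x)"
  unfolding shatters_def as_partial_def by simp

lemma forces_shattering_mono: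
  assumes "forces_shattering P H d" "P \<subseteq> P'" "H \<subseteq> H'"
  shows "forces_shattering P' H' d"
proof -
  have "completes F H" if "completes F H'" for F
    using that assms(3) unfolding completes_def by blast
  then show ?thesis using assms(1,2) unfolding forces_shattering_def by (meson order.trans)
qed

section \<open>Littlestone and VC dimension bounds\<close>

lemma LD_le_2:
  assumes "zero_one_unique H"
  shows "LD X H \<le> 2"
  unfolding LD_def
proof (rule Sup_least, clarify)
  fix d t assume t: "shatters_tree X H d t"
  have "d \<le> 2"
  proof (rule ccontr)
    assume "\<not> d \<le> 2"
    then have d: "d = 3 + (d - 3)" by simp
    \<comment> \<open>The branches 0, 1, 0 and 0, 1, 1 need different concepts sharing the values at
      the first two nodes. Padding by \<open>False\<close> reaches the full depth
      \<open>d\<close>.\<close>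
    have "\<exists>h\<in>H. h (t []) = Some False \<and> h (t [False]) = Some True \<and> h (t [False, True]) = Some b" for b
    proof -
      let ?y = "[False, True, b] @ replicate (d - 3) False"
      have "length ?y = d" using d by simp
      then obtain h where h: "h \<in> H" "\<And>i. i < d \<Longrightarrow> h (t (take i ?y)) = Some (?y ! i)"
        using t unfolding shatters_tree_def by blast
      have "0 < d" "1 < d" "2 < d" using d by linarith+
      from h(2)[OF this(1)] h(2)[OF this(2)] h(2)[OF this(3)] h(1)
      show ?thesis by (intro bexI[of _ h]) (simp_all add: numeral_2_eq_2)
    qed
    from this[of True] this[of False] obtain h h' where
      "h \<in> H" "h (t []) = Some False" "h (t [False]) = Some True" "h (t [False, True]) = Some True"
      "h' \<in> H" "h' (t []) = Some False" "h' (t [False]) = Some True" "h' (t [False, True]) = Some False"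
      by blast
    then show False using assms unfolding zero_one_unique_def by (metis option.inject)
  qed
  then show "enat d \<le> 2" by (simp add: numeral_eq_enat)
qed

text \<open>Label every node at depth \<open>i\<close> with the \<open>i\<close>-th point of the
  shattered set.\<close>

lemma VC_le_LD: "VC X H \<le> LD X H"
  unfolding VC_def
proof (rule Sup_least, clarify)
  fix S assume S: "S \<subseteq> X" "shatters H S"
  then have "finite S" by (simp add: shatters_def)
  then obtain e where e: "bij_betw e {..<card S} S"
    using ex_bij_betw_nat_finite[of S] by (auto simp: atLeast0LessThan)
  have eS: "e i \<in> S" if "i < card S" for i using bij_betwE[OF e] that by blast
  have "shatters_tree X H (card S) (\<lambda>v. e (length v))"
    unfolding shatters_tree_def
  proof (intro conjI allI impI)
    fix v :: "bool list" assume "length v < card S"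
    then show "e (length v) \<in> X" using eS S(1) by blast
  next
    fix y :: "bool list" assume y: "length y = card S"
    obtain h where h: "h \<in> H" "\<forall>x\<in>S. h x = Some (y ! inv_into {..<card S} e x)"
      using S(2) unfolding shatters_def by meson
    have "h (e (length (take i y))) = Some (y ! i)" if "i < card S" for i
      using h(2) eS[OF that] that y bij_betw_imp_inj_on[OF e] by (simp add: inv_into_f_f)
    then show "\<exists>h\<in>H. \<forall>i<card S. h (e (length (take i y))) = Some (y ! i)" using h(1) by blast
  qed
  then show "enat (card S) \<le> LD X H" unfolding LD_def by (intro Sup_upper) blast
qed

text \<open>As supports are finite, the finite set in the definition of a disambiguation can be the
  entire support.\<close>

lemma VC_disambiguation_ge:
  assumes H: "forces_shattering X H d" and D: "disambiguation X H Hb"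
    and fin: "\<And>h. h \<in> H \<Longrightarrow> finite {x. h x \<noteq> None} \<and> {x. h x \<noteq> None} \<subseteq> X"
  shows "enat d \<le> VC X (as_partial Hb)"
proof -
  have "completes Hb H"
    unfolding completes_def
  proof
    fix h assume h: "h \<in> H"
    obtain f where "f \<in> Hb" "\<forall>x\<in>{x. h x \<noteq> None}. h x = Some (f x)"
      using D h fin[OF h] unfolding disambiguation_def by blast
    then show "\<exists>f\<in>Hb. \<forall>x b. h x = Some b \<longrightarrow> f x = b" by (intro bexI[of _ f]) force+
  qed
  then obtain S where "S \<subseteq> X" "card S = d" "shatters (as_partial Hb) S"
    using H unfolding forces_shattering_def by blast
  then show ?thesis unfolding VC_def by (intro Sup_upper) blast
qed

section \<open>Transport of classes along injections\<close>

definition push :: "('p \<Rightarrow> 'q) \<Rightarrow> 'p set \<Rightarrow> 'p pconcept \<Rightarrow> 'q pconcept" where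
  "push \<phi> P h = (\<lambda>z. if z \<in> \<phi> ` P then h (inv_into P \<phi> z) else None)"

lemma push_apply: "inj_on \<phi> P \<Longrightarrow> x \<in> P \<Longrightarrow> push \<phi> P h (\<phi> x) = h x"
  by (simp add: push_def)

lemma push_SomeE:
  assumes "push \<phi> P h z = Some b" "inj_on \<phi> P"
  obtains x where "x \<in> P" "z = \<phi> x" "h x = Some b"
  using assms by (auto simp: push_def split: if_splits)

lemma zero_one_unique_push:
  assumes "zero_one_unique H" "inj_on \<phi> P"
  shows "zero_one_unique (push \<phi> P ` H)"
  unfolding zero_one_unique_def
proof (intro ballI allI impI)
  fix g g' p q
  assume "g \<in> push \<phi> P ` H" "g' \<in> push \<phi> P ` H"
  then obtain h h' where h: "h \<in> H" "g = push \<phi> P h" "h' \<in> H" "g' = push \<phi> P h'" by blast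
  assume g: "g p = Some False" "g q = Some True" "g' p = Some False" "g' q = Some True"
  obtain x where x: "x \<in> P" "p = \<phi> x" by (rule push_SomeE[OF g(1)[unfolded h(2)] assms(2)])
  obtain x' where x': "x' \<in> P" "q = \<phi> x'" by (rule push_SomeE[OF g(2)[unfolded h(2)] assms(2)])
  have "h x = Some False" "h x' = Some True" "h' x = Some False" "h' x' = Some True"
    using g push_apply[OF assms(2)] x x' by (simp_all add: h)
  then have "h = h'" using assms(1) h unfolding zero_one_unique_def by blast
  then show "g = g'" by (simp add: h)
qed

text \<open>A completion of the pushed class, composed with \<open>\<phi>\<close>, completes
  \<open>H\<close>; the set it shatters is then mapped forward by \<open>\<phi>\<close>. The support
  condition ensures that \<open>push\<close> loses no value.\<close>

lemma forces_shattering_push: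
  assumes H: "forces_shattering P H d" and inj: "inj_on \<phi> P"
    and supp: "\<And>h x. h \<in> H \<Longrightarrow> x \<notin> P \<Longrightarrow> h x = None"
  shows "forces_shattering (\<phi> ` P) (push \<phi> P ` H) d"
  unfolding forces_shattering_def
proof (intro allI impI)
  fix F :: "('b \<Rightarrow> bool) set"
  assume F: "completes F (push \<phi> P ` H)"
  have "completes ((\<lambda>f. f \<circ> \<phi>) ` F) H"
    unfolding completes_def
  proof
    fix h assume h: "h \<in> H"
    then obtain f where f: "f \<in> F" "\<And>z b. push \<phi> P h z = Some b \<Longrightarrow> f z = b"
      using F unfolding completes_def by blast
    have "(f \<circ> \<phi>) x = b" if "h x = Some b" for x b
    proof -
      have "x \<in> P" using supp[OF h, of x] that by (cases "x \<in> P") auto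
      then show ?thesis using f(2)[of "\<phi> x" b] push_apply[OF inj] that by simp
    qed
    then show "\<exists>f\<in>(\<lambda>f. f \<circ> \<phi>) ` F. \<forall>x b. h x = Some b \<longrightarrow> f x = b" using f(1) by blast
  qed
  then obtain S where S: "S \<subseteq> P" "card S = d" "shatters (as_partial ((\<lambda>f. f \<circ> \<phi>) ` F)) S"
    using H unfolding forces_shattering_def by blast
  have "\<exists>f\<in>F. \<forall>z\<in>\<phi> ` S. f z = y z" for y
  proof -
    have "\<exists>f\<in>(\<lambda>f. f \<circ> \<phi>) ` F. \<forall>x\<in>S. f x = (y \<circ> \<phi>) x"
      using S(3) unfolding shatters_as_partial by blast
    then show ?thesis by (simp add: image_iff)
  qed
  then have "shatters (as_partial F) (\<phi> ` S)" using S(3) unfolding shatters_as_partial by blast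
  moreover have "card (\<phi> ` S) = d" using S(2) inj_on_subset[OF inj S(1)] by (simp add: card_image)
  ultimately show "\<exists>S\<subseteq>\<phi> ` P. card S = d \<and> shatters (as_partial F) S"
    using S(1) by (intro exI[of _ "\<phi> ` S"]) blast
qed

section \<open>The hard classes on finite domains and on the natural numbers\<close>

lemma hard_class_exists:
  assumes g: "5 \<le> g"
  obtains P :: "cell point set" and H where "finite P" "card P \<le> 2 ^ 2 ^ (64 * g)"
    "\<And>h x. h \<in> H \<Longrightarrow> x \<notin> P \<Longrightarrow> h x = None" "zero_one_unique H" "forces_shattering P H g"
proof -
  \<comment> \<open>The Sauer--Shelah exponent \<open>2 ^ g\<close> becomes \<open>s\<close>. The
    DNF has width \<open>9 * s ^ 6\<close>, certificates of size \<open>s ^ 8\<close> and at most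
    \<open>5 * s ^ 15\<close> cells. So \<open>many_colours\<close> is used with
    \<open>k = 6 * s ^ 15\<close>, which asks for \<open>432 * s ^ 21 \<le> r\<close>;
    \<open>s ^ 24\<close> is ample. The gadget alphabet has size \<open>s ^ 48\<close>.\<close>
  define s where "s = (2::nat) ^ g"
  define r where "r = s ^ 24"
  define I where "I = block_cells s"
  define C where "C = block_dnf s"
  define P where "P = points I (r\<^sup>2)"
  define H where "H = lifted_class I (r\<^sup>2) C"
  have "(2::nat) ^ 5 \<le> 2 ^ g" using g by (intro power_increasing) auto
  then have s: "32 \<le> s" by (simp add: s_def)
  have r1: "1 < r" "s \<le> r" using s self_le_power[of s 24] by (simp_all add: r_def)
  have I: "finite I" "card I \<le> 4 * s ^ 12 + s ^ 15" using block_cells by (simp_all add: I_def)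
  have L: "card I \<le> 5 * s ^ 15"
    using I(2) power_increasing[of 12 15 s] s by linarith
  have gs: "g < s" by (simp add: s_def)
  have C: "cells c \<subseteq> I \<and> card (cells c) \<le> 9 * s ^ 6 \<and> fst c \<noteq> {} \<and> fst c \<inter> snd c = {}"
    if c: "c \<in> C" for c
  proof -
    have "2 < s" using s by simp
    then show ?thesis
      using c block_term_props[of s] unfolding C_def I_def block_dnf_def by blast
  qed
  have Cfin: "\<forall>c\<in>C. finite (cells c) \<and> card (cells c) \<le> 9 * s ^ 6"
    using C I(1) finite_subset by blast
  have "finite C" "card C \<le> s ^ 15 * 2 ^ s ^ 3" using block_dnf_card by (simp_all add: C_def)
  have "0 < r\<^sup>2" using r1 by simp
  note H_card = lifted_class_card[OF \<open>finite C\<close> Cfin this, of I, folded H_def]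
  have finP: "finite P" "card P \<le> (r\<^sup>2) ^ card I * 2 ^ (card I * r\<^sup>2)"
    using points_card[OF I(1)] by (simp_all add: P_def)
  have colours: "r ^ s ^ 8 \<le> card (col ` P)"
    if col: "\<And>h p q. h \<in> H \<Longrightarrow> p \<in> P \<Longrightarrow> q \<in> P \<Longrightarrow> col p = col q \<Longrightarrow>
       h p = Some False \<Longrightarrow> h q \<noteq> Some True" for col :: "cell point \<Rightarrow> cell point pconcept set"
    unfolding P_def
  proof (rule many_colours[OF I(1) C, where k = "6 * s ^ 15"])
    fix T assume T: "T \<subseteq> I" "card T < s ^ 8"
    have "2 < s" "finite T" using s T(1) I(1) finite_subset by auto
    then show "\<exists>c\<in>C. fst c \<inter> T = {}" unfolding C_def using T(2) by (intro block_dnf_avoids)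
  next
    have "432 * s ^ 21 \<le> s ^ 3 * s ^ 21"
      using power_mono[OF s, of 3] by (intro mult_right_mono) auto
    then show "8 * (6 * s ^ 15) * (9 * s ^ 6) \<le> r" by (simp add: r_def flip: power_add)
    show "1 < r" "0 < 6 * s ^ 15" using r1 s by simp_all
    have "r ^ s ^ 8 = 2 ^ (g * 24 * s ^ 8)" by (simp add: r_def s_def flip: power_mult)
    also have "\<dots> \<le> 2 ^ s ^ 15"
    proof (rule power_increasing)
      have "g * 24 * s ^ 8 \<le> s * s * s ^ 8" using gs s by (intro mult_mono) auto
      also have "\<dots> = s ^ 10" by (simp flip: power_add power2_eq_square)
      also have "\<dots> \<le> s ^ 15" using s by (intro power_increasing) auto
      finally show "g * 24 * s ^ 8 \<le> s ^ 15" .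
    qed simp
    finally have "2 ^ card I * r ^ s ^ 8 \<le> 2 ^ (5 * s ^ 15) * 2 ^ s ^ 15"
      using L by (intro mult_mono power_increasing) auto
    then show "2 ^ card I * r ^ s ^ 8 \<le> 2 ^ (6 * s ^ 15)" by (simp flip: power_add)
  next
    fix h p q assume "h \<in> lifted_class I (r\<^sup>2) C" "p \<in> points I (r\<^sup>2)" "q \<in> points I (r\<^sup>2)"
      "col p = col q" "h p = Some False"
    then show "h q \<noteq> Some True" using col[of h p q] by (simp add: H_def P_def)
  qed
  \<comment> \<open>There are fewer than \<open>r ^ (20 * s ^ 6)\<close> concepts, up to equality,
    and their number is raised to the power \<open>s\<close>. The gap to \<open>r ^ s ^ 8\<close> is
    \<open>20 < s\<close>, which holds as \<open>5 \<le> g\<close> gives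
    \<open>32 \<le> s\<close>.\<close>
  have few_rows: "(card H + 1) ^ 2 ^ g < r ^ s ^ 8"
  proof -
    have "card H + 1 \<le> 2 * (s ^ 15 * 2 ^ s ^ 3 * (r\<^sup>2) ^ (9 * s ^ 6))"
    proof -
      have "card H \<le> s ^ 15 * 2 ^ s ^ 3 * (r\<^sup>2) ^ (9 * s ^ 6)"
        using H_card(2) \<open>card C \<le> _\<close> by (meson le_trans mult_le_mono1)
      moreover have "1 \<le> s ^ 15 * 2 ^ s ^ 3 * (r\<^sup>2) ^ (9 * s ^ 6)"
        using s r1 by (simp add: Suc_le_eq)
      ultimately show ?thesis by linarith
    qed
    also have "\<dots> = (2 * s ^ 15) * 2 ^ s ^ 3 * (r\<^sup>2) ^ (9 * s ^ 6)" by simp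
    also have "\<dots> \<le> r ^ s ^ 6 * r ^ s ^ 6 * (r\<^sup>2) ^ (9 * s ^ 6)"
    proof (intro mult_mono)
      have "2 * s ^ 15 \<le> s * s ^ 15" using s by simp
      also have "\<dots> = s ^ 16" by (simp flip: power_Suc)
      also have "\<dots> \<le> r" unfolding r_def using s by (intro power_increasing) auto
      also have "\<dots> \<le> r ^ s ^ 6" using r1 s by (intro self_le_power) auto
      finally show "2 * s ^ 15 \<le> r ^ s ^ 6" .
      have "2 ^ s ^ 3 \<le> r ^ s ^ 3" using r1 by (intro power_mono) auto
      also have "\<dots> \<le> r ^ s ^ 6" using r1 s by (intro power_increasing) auto
      finally show "2 ^ s ^ 3 \<le> r ^ s ^ 6" .
    qed auto
    also have "\<dots> = r ^ (20 * s ^ 6)" by (simp flip: power_add power_mult)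
    finally have "(card H + 1) ^ 2 ^ g \<le> (r ^ (20 * s ^ 6)) ^ s"
      unfolding s_def[symmetric] by (intro power_mono) auto
    also have "\<dots> = r ^ (20 * s ^ 7)"
    proof -
      have "20 * s ^ 6 * s = 20 * s ^ 7" using power_Suc2[of s 6] by simp
      then show ?thesis by (simp only: power_mult[symmetric])
    qed
    also have "\<dots> < r ^ (s * s ^ 7)" using r1(1) s by (intro power_strict_increasing) auto
    finally show ?thesis by (simp flip: power_Suc)
  qed
  show ?thesis
  proof
    show "finite P" by (rule finP)
    show "card P \<le> 2 ^ 2 ^ (64 * g)"
    proof -
      have N: "r\<^sup>2 = s ^ 48" by (simp add: r_def flip: power_mult)
      have "(r\<^sup>2) ^ card I = 2 ^ (g * 48 * card I)"
        unfolding N by (simp add: s_def flip: power_mult)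
      then have "card P \<le> 2 ^ (g * 48 * card I + card I * s ^ 48)"
        using finP(2) unfolding N by (simp add: power_add)
      also have "\<dots> \<le> 2 ^ s ^ 64"
      proof (rule power_increasing)
        have "g * 48 \<le> s * s ^ 2" using gs s power_mono[OF s, of 2] by (intro mult_mono) auto
        also have "\<dots> \<le> s ^ 48" using s power_increasing[of 3 48 s] by (simp flip: power_Suc)
        finally have "(g * 48 + s ^ 48) * card I \<le> (2 * s ^ 48) * (5 * s ^ 15)"
          using L by (intro mult_mono) auto
        also have "\<dots> = 10 * s ^ 63" by (simp flip: power_add)
        also have "\<dots> \<le> s * s ^ 63" using s by simp
        finally show "g * 48 * card I + card I * s ^ 48 \<le> s ^ 64"
          by (simp add: algebra_simps flip: power_Suc)
      qed simp
      also have "s ^ 64 = 2 ^ (64 * g)" by (simp add: s_def mult.commute flip: power_mult)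
      finally show ?thesis .
    qed
    show "h x = None" if "h \<in> H" "x \<notin> P" for h x
      using that by (cases x) (auto simp: H_def P_def lifted_class_def lifted_term_def)
    show "zero_one_unique H"
      unfolding H_def C_def using s by (intro zero_one_unique_lifted block_dnf_unambiguous) simp
    show "forces_shattering P H g"
      unfolding forces_shattering_def
    proof (intro allI impI)
      fix F :: "(cell point \<Rightarrow> bool) set"
      assume "completes F H"
      from bchoice[OF this[unfolded completes_def Bex_def]]
      obtain f where f: "\<And>h. h \<in> H \<Longrightarrow> f h \<in> F" "\<And>h x b. h \<in> H \<Longrightarrow> h x = Some b \<Longrightarrow> f h x = b"
        by blast
      \<comment> \<open>The colour of a point is its column: the concepts whose chosen completion is
        1 there. A concept with values 0 and 1 at two points puts them in different columns.\<close>
      have "r ^ s ^ 8 \<le> card ((\<lambda>p. {h \<in> H. f h p}) ` P)"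
      proof (rule colours)
        fix h p q assume h: "h \<in> H" "{h \<in> H. f h p} = {h \<in> H. f h q}" "h p = Some False"
        then have "\<not> f h p" using f(2) by blast
        then have "\<not> f h q" using h(1,2) by blast
        then show "h q \<noteq> Some True" using f(2)[OF h(1), of q] by blast
      qed
      with few_rows have "(card H + 1) ^ 2 ^ g < card ((\<lambda>p. {h \<in> H. f h p}) ` P)"
        by (rule less_le_trans)
      then obtain S where S: "S \<subseteq> P" "finite S" "card S = g" "\<forall>y. \<exists>h\<in>H. \<forall>p\<in>S. f h p = y p"
        by (rule shattered_of_many_columns[OF H_card(1)])
      have "\<exists>f\<in>F. \<forall>x\<in>S. f x = y x" for y
      proof -
        obtain h where "h \<in> H" "\<forall>p\<in>S. f h p = y p" using S(4) by blast
        then show ?thesis using f(1) by blast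
      qed
      then have "shatters (as_partial F) S" using S(2) unfolding shatters_as_partial by blast
      then show "\<exists>S\<subseteq>P. card S = g \<and> shatters (as_partial F) S" using S(1,3) by blast
    qed
  qed
qed

lemma hard_class_initial_segment:
  fixes n :: nat
  assumes "5 \<le> g" "2 ^ 2 ^ (64 * g) \<le> n"
  obtains H where "partial_class_on {1..n} H" "zero_one_unique H" "forces_shattering {1..n} H g"
proof -
  obtain P :: "cell point set" and H where P: "finite P" "card P \<le> 2 ^ 2 ^ (64 * g)"
    and H: "\<And>h x. h \<in> H \<Longrightarrow> x \<notin> P \<Longrightarrow> h x = None" "zero_one_unique H" "forces_shattering P H g"
    using hard_class_exists[OF assms(1)] by blast
  have "card P \<le> card {1..n}" using P(2) assms(2) by simp
  then obtain \<phi> where \<phi>: "\<phi> ` P \<subseteq> {1..n}" "inj_on \<phi> P"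
    using card_le_inj[OF P(1), of "{1..n}"] by auto
  show ?thesis
  proof
    show "partial_class_on {1..n} (push \<phi> P ` H)"
      using \<phi>(1) unfolding partial_class_on_def push_def by auto
    show "zero_one_unique (push \<phi> P ` H)" by (rule zero_one_unique_push[OF H(2) \<phi>(2)])
    have "forces_shattering (\<phi> ` P) (push \<phi> P ` H) g"
      by (rule forces_shattering_push[OF H(3) \<phi>(2)]) (rule H(1))
    then show "forces_shattering {1..n} (push \<phi> P ` H) g"
      using \<phi>(1) by (rule forces_shattering_mono) simp
  qed
qed

text \<open>Disjoint copies of the finite classes for all \<open>g\<close> are placed on the pairs
  with first component \<open>g\<close>, each concept undefined off its own copy. A point of value 0
  reveals \<open>g\<close>, so uniqueness passes from the single classes to the union.\<close>

lemma hard_class_nat: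
  obtains H :: "nat pconcept set" where "zero_one_unique H" "\<And>h. h \<in> H \<Longrightarrow> finite {x. h x \<noteq> None}"
    "\<And>g. 5 \<le> g \<Longrightarrow> forces_shattering UNIV H g"
proof -
  have "\<exists>n H :: nat pconcept set. partial_class_on {1..n} H \<and> zero_one_unique H \<and> forces_shattering {1..n} H g"
    if g: "5 \<le> g" for g
    using hard_class_initial_segment[OF g order.refl] by blast
  then obtain n H where H: "\<And>g. 5 \<le> g \<Longrightarrow> partial_class_on {1..n g} (H g :: nat pconcept set)"
      "\<And>g. 5 \<le> g \<Longrightarrow> zero_one_unique (H g)" "\<And>g. 5 \<le> g \<Longrightarrow> forces_shattering {1..n g} (H g) g"
    by metis
  define \<phi> where "\<phi> g x = prod_encode (g, x)" for g x :: nat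
  have inj: "inj_on (\<phi> g) A" for g A by (auto simp: \<phi>_def inj_on_def)
  define K where "K = (\<Union>g\<in>{5..}. push (\<phi> g) {1..n g} ` H g)"
  show ?thesis
  proof
    show "zero_one_unique K"
      unfolding zero_one_unique_def
    proof (intro ballI allI impI)
      fix k k' p q assume k: "k \<in> K" "k' \<in> K"
        and val: "k p = Some False" "k q = Some True" "k' p = Some False" "k' q = Some True"
      obtain g where g: "5 \<le> g" "k \<in> push (\<phi> g) {1..n g} ` H g" using k(1) by (auto simp: K_def)
      obtain g' where g': "5 \<le> g'" "k' \<in> push (\<phi> g') {1..n g'} ` H g'" using k(2) by (auto simp: K_def)
      have "\<exists>x. p = \<phi> g x" using g(2) val(1) by (auto elim: push_SomeE[OF _ inj])
      moreover have "\<exists>x. p = \<phi> g' x" using g'(2) val(3) by (auto elim: push_SomeE[OF _ inj])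
      ultimately have "g = g'" by (auto simp: \<phi>_def)
      then show "k = k'"
        using zero_one_unique_push[OF H(2)[OF g(1)] inj] g(2) g'(2) val
        unfolding zero_one_unique_def by blast
    qed
    show "finite {x. k x \<noteq> None}" if k: "k \<in> K" for k
    proof -
      obtain g h where "k = push (\<phi> g) {1..n g} h" using k unfolding K_def by blast
      then have "{x. k x \<noteq> None} \<subseteq> \<phi> g ` {1..n g}" by (auto simp: push_def split: if_splits)
      then show ?thesis by (rule finite_subset) simp
    qed
    show "forces_shattering UNIV K g" if g: "5 \<le> g" for g
    proof -
      have "h x = None" if "h \<in> H g" "x \<notin> {1..n g}" for h x
        using H(1)[OF g] that unfolding partial_class_on_def by blast
      then have "forces_shattering (\<phi> g ` {1..n g}) (push (\<phi> g) {1..n g} ` H g) g"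
        by (rule forces_shattering_push[OF H(3)[OF g] inj])
      then show ?thesis by (rule forces_shattering_mono) (use g in \<open>auto simp: K_def\<close>)
    qed
  qed
qed

text \<open>Taking logarithms twice, with \<open>ln 2 < 1\<close>, leaves
  \<open>64 * (g + 1)\<close>, at most \<open>128 * g\<close>. This is the source of the constant
  1/128.\<close>

lemma ln_ln_le:
  assumes "2 \<le> n" "n < 2 ^ 2 ^ (64 * (g + 1))" "1 \<le> g"
  shows "ln (ln (real n)) \<le> 128 * real g"
proof -
  have half: "ln (2 ^ m) \<le> real m" for m :: nat
    using ln_2_less_1 by (simp add: ln_realpow mult_left_le)
  have "0 < ln (real n)" using assms(1) by simp
  have "real n \<le> 2 ^ 2 ^ (64 * (g + 1))"
    using assms(2) by (metis less_imp_le of_nat_le_iff of_nat_numeral of_nat_power)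
  then have "ln (real n) \<le> ln (2 ^ 2 ^ (64 * (g + 1)))" using assms(1) by (intro ln_mono) auto
  also have "\<dots> \<le> 2 ^ (64 * (g + 1))" using half[of "2 ^ (64 * (g + 1))"] by simp
  finally have "ln (ln (real n)) \<le> ln (2 ^ (64 * (g + 1)))"
    using \<open>0 < ln (real n)\<close> by (intro ln_mono) auto
  also have "\<dots> \<le> real (64 * (g + 1))" by (rule half)
  also have "\<dots> \<le> 128 * real g" using assms(3) by simp
  finally show ?thesis .
qed

theorem mainTheorem1:
  shows "(\<exists>c::real. c > 0 \<and>
           (\<exists>N::nat. \<forall>n\<ge>N. \<exists>H :: nat pconcept set.
              partial_class_on {1..n} H \<and> LD {1..n} H \<le> 2 \<and>
              (\<forall>Hb. disambiguation {1..n} H Hb \<longrightarrow>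
                 VC {1..n} (as_partial Hb) \<le> LD {1..n} (as_partial Hb) \<and>
                 enat (nat \<lceil>c * ln (ln (real n))\<rceil>) \<le> VC {1..n} (as_partial Hb))))
       \<and> (\<exists>H :: nat pconcept set.
              partial_class_on (UNIV :: nat set) H \<and> LD UNIV H \<le> 2 \<and>
              (\<forall>Hb. disambiguation UNIV H Hb \<longrightarrow>
                 VC UNIV (as_partial Hb) \<le> LD UNIV (as_partial Hb) \<and>
                 VC UNIV (as_partial Hb) = \<infinity>))"
proof
  define M :: "nat \<Rightarrow> nat" where "M g = 2 ^ 2 ^ (64 * g)" for g
  have Mg: "g < M g" for g
  proof -
    have "g < 2 ^ g" by simp
    also have "\<dots> \<le> 2 ^ (64 * g)" by (intro power_increasing) auto
    also have "\<dots> < M g" by (simp add: M_def)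
    finally show ?thesis .
  qed
  show "\<exists>c::real. c > 0 \<and>
           (\<exists>N::nat. \<forall>n\<ge>N. \<exists>H :: nat pconcept set.
              partial_class_on {1..n} H \<and> LD {1..n} H \<le> 2 \<and>
              (\<forall>Hb. disambiguation {1..n} H Hb \<longrightarrow>
                 VC {1..n} (as_partial Hb) \<le> LD {1..n} (as_partial Hb) \<and>
                 enat (nat \<lceil>c * ln (ln (real n))\<rceil>) \<le> VC {1..n} (as_partial Hb)))"
  proof (intro exI[of _ "1 / 128 :: real"] exI[of _ "M 5"] conjI allI impI)
    fix n assume n: "M 5 \<le> n"
    have fin: "finite {g. M g \<le> n}"
    proof (rule finite_subset)
      show "{g. M g \<le> n} \<subseteq> {..n}"
      proof clarify
        fix g assume "M g \<le> n"
        then show "g \<le> n" using Mg[of g] by linarith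
      qed
    qed simp
    \<comment> \<open>For the largest \<open>g\<close> with \<open>M g \<le> n\<close> the class
      still fits into the domain, while \<open>n < M (g + 1)\<close> makes \<open>g\<close> at least
      a constant multiple of \<open>ln (ln n)\<close>.\<close>
    define g where "g = Max {g. M g \<le> n}"
    have g: "5 \<le> g" "M g \<le> n" "n < M (g + 1)"
    proof -
      show "5 \<le> g" unfolding g_def using n by (intro Max_ge[OF fin]) simp
      have "g \<in> {g. M g \<le> n}" unfolding g_def using n by (intro Max_in[OF fin]) blast
      then show "M g \<le> n" by simp
      have "\<not> M (g + 1) \<le> n" using Max_ge[OF fin, of "g + 1"] unfolding g_def[symmetric] by auto
      then show "n < M (g + 1)" by simp
    qed
    obtain H where H: "partial_class_on {1..n} H" "zero_one_unique H" "forces_shattering {1..n} H g"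
      by (rule hard_class_initial_segment[OF g(1) g(2)[unfolded M_def]])
    have supp: "finite {x. h x \<noteq> None} \<and> {x. h x \<noteq> None} \<subseteq> {1..n}" if "h \<in> H" for h
    proof -
      have sub: "{x. h x \<noteq> None} \<subseteq> {1..n}"
      proof (intro subsetI, rule ccontr)
        fix x assume "x \<in> {x. h x \<noteq> None}" "x \<notin> {1..n}"
        then show False using H(1)[unfolded partial_class_on_def, rule_format, OF that, of x] by simp
      qed
      show ?thesis using finite_subset[OF sub finite_atLeastAtMost] sub by (rule conjI)
    qed
    have "2 \<le> n" using Mg[of g] g(1,2) by linarith
    then have "ln (ln (real n)) \<le> 128 * real g"
      using g(1) by (intro ln_ln_le[OF _ g(3)[unfolded M_def]]) simp_all
    then have le: "nat \<lceil>1 / 128 * ln (ln (real n))\<rceil> \<le> g" by (simp add: nat_le_iff ceiling_le_iff)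
    show "\<exists>H. partial_class_on {1..n} H \<and> LD {1..n} H \<le> 2 \<and>
      (\<forall>Hb. disambiguation {1..n} H Hb \<longrightarrow>
         VC {1..n} (as_partial Hb) \<le> LD {1..n} (as_partial Hb) \<and>
         enat (nat \<lceil>1 / 128 * ln (ln (real n))\<rceil>) \<le> VC {1..n} (as_partial Hb))"
    proof (intro exI[of _ H] conjI allI impI H(1) LD_le_2[OF H(2)] VC_le_LD)
      fix Hb assume "disambiguation {1..n} H Hb"
      from VC_disambiguation_ge[OF H(3) this supp]
      have "enat g \<le> VC {1..n} (as_partial Hb)" .
      moreover have "enat (nat \<lceil>1 / 128 * ln (ln (real n))\<rceil>) \<le> enat g" using le by simp
      ultimately show "enat (nat \<lceil>1 / 128 * ln (ln (real n))\<rceil>) \<le> VC {1..n} (as_partial Hb)"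
        by (rule order.trans[rotated])
    qed
  qed simp
  obtain H :: "nat pconcept set" where H: "zero_one_unique H" "\<And>h. h \<in> H \<Longrightarrow> finite {x. h x \<noteq> None}"
    "\<And>g. 5 \<le> g \<Longrightarrow> forces_shattering UNIV H g"
    using hard_class_nat by blast
  show "\<exists>H :: nat pconcept set.
              partial_class_on (UNIV :: nat set) H \<and> LD UNIV H \<le> 2 \<and>
              (\<forall>Hb. disambiguation UNIV H Hb \<longrightarrow>
                 VC UNIV (as_partial Hb) \<le> LD UNIV (as_partial Hb) \<and>
                 VC UNIV (as_partial Hb) = \<infinity>)"
  proof (intro exI[of _ H] conjI allI impI LD_le_2[OF H(1)] VC_le_LD)
    show "partial_class_on UNIV H" by (simp add: partial_class_on_def)
    fix Hb assume D: "disambiguation UNIV H Hb"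
    have ge: "enat g \<le> VC UNIV (as_partial Hb)" if "5 \<le> g" for g
      by (rule VC_disambiguation_ge[OF H(3)[OF that] D]) (use H(2) in auto)
    show "VC UNIV (as_partial Hb) = \<infinity>"
    proof (cases "VC UNIV (as_partial Hb)")
      case (enat m)
      \<comment> \<open>The value \<open>m + 5\<close> both exceeds \<open>m\<close> and meets the
        requirement \<open>5 \<le> g\<close>.\<close>
      then show ?thesis using ge[of "m + 5"] by simp
    qed simp
  qed
qed

end
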